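(* Consider the LPV system with behavior $\mathfrak{B}$ and set of admissible scheduling trajectories $\mathscr{P}$ described in the context, let $\mathcal{D}_N=\{u_k,p_k,y_k\}_{k=1}^N$ with $(u_{[1,N]},p_{[1,N]},y_{[1,N]})\in\mathfrak{B}|_{[1,N]}$ be a data set from this system, let $1\le L<N$, and let the supply rate be given by $(Q,S,R)$. Let $\Pi_H$ and $F(\bar p_{[1,L]})$ (the latter depending on an integer $\tau\in\mathbb{N}$) be the matrices constructed from the data in the context. Consider, for $\bar p_{[1,L]}\in\mathscr{P}_{[1,L]}$, the condition $$(\ast)\qquad g^\top \Pi_H\, g\ge 0\quad\text{for all } g\in\mathbb{R}^{N-L+1}\text{ with } F(\bar p_{[1,L]})\,g=0 .$$ Then the following statements hold: (i) If the system is $L$-dissipative with respect to a given $(Q,S,R)$, then for any $\tau$ with $n_\mathrm{r}\le\tau<L$ and any $\bar p_{[1,L]}\in\mathscr{P}_{[1,L]}$, condition $(\ast)$ holds. (ii) Conversely, suppose the system generates a data set $\mathcal{D}_N$ that is persistently exciting of order $(L,n_\mathrm{x})$. If there exists $\tau<L$ such that $(\ast)$ holds for all $\bar p_{[1,L]}\in\mathscr{P}_{[1,L]}$, then the system is $(L-\tau)$-dissipative with respect to $(Q,S,R)$.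
   Context: **System.** Let $\mathbb{N}$ be the positive integers. The system is represented by the shifted-affine LPV (linear parameter-varying) input-output representation $$y_k+\sum_{i=1}^{n_\mathrm{a}}a_i(p_{k-i})y_{k-i}=\sum_{i=0}^{n_\mathrm{b}}b_i(p_{k-i})u_{k-i},\qquad k\in\mathbb{N},$$ with $u_k\in\mathbb{R}^{n_\mathrm{u}}$, $y_k\in\mathbb{R}^{n_\mathrm{y}}$, scheduling $p_k\in\mathbb{P}\subseteq\mathbb{R}^{n_\mathrm{p}}$, $\mathbb{P}$ convex and compact, $n_\mathrm{a}\ge1$, $n_\mathrm{b}\ge0$, where $a_i(p_{k-i})=\sum_{j=0}^{n_\mathrm{p}}a_{i,j}p_{k-i,j}$ and $b_i(p_{k-i})=\sum_{j=0}^{n_\mathrm{p}}b_{i,j}p_{k-i,j}$ with constant matrices $a_{i,j},b_{i,j}$; here $p_{k,j}$ is the $j$-th entry of $p_k$ and $p_{k,0}=1$. Put $n_\mathrm{r}=\max(n_\mathrm{a},n_\mathrm{b})$. The initial condition $w_0$ collects $\{y_k\}_{k=1-n_\mathrm{a}}^0$, $\{p_k\}_{k=1-n_\mathrm{r}}^0$, $\{u_k\}_{k=1-n_\mathrm{b}}^0$, and ranges over $\mathbb{W}_0=\mathbb{R}^{n_\mathrm{a}n_\mathrm{y}}\times\mathbb{P}^{n_\mathrm{r}}\times\mathbb{R}^{n_\mathrm{b}n_\mathrm{u}}$. It is assumed that, with $q$ the shift operator, $q^{n_\mathrm{r}}(1+\sum_{i=1}^{n_\mathrm{a}}a_i(p_{k-i})q^{-i})$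 and $q^{n_\mathrm{r}}\sum_{i=0}^{n_\mathrm{b}}b_i(p_{k-i})q^{-i}$ are coprime and compose a full row rank matrix polynomial in $q$ (so the representation is minimal). **Behaviors.** $\mathscr{P}\subseteq\mathbb{P}^{\mathbb{N}}$ is the set of admissible scheduling trajectories (e.g. $\mathscr{P}=\mathbb{P}^{\mathbb{N}}$). The behavior $\mathfrak{B}$ is the set of all $(u,p,y)\in(\mathbb{R}^{n_\mathrm{u}}\times\mathbb{P}\times\mathbb{R}^{n_\mathrm{y}})^{\mathbb{N}}$ with $p\in\mathscr{P}$ for which there is $w_0\in\mathbb{W}_0$ such that the difference equation holds for all $k\in\mathbb{N}$. $\mathfrak{B}_{\mathrm{IO}}$ is its projection onto $(u,y)$, and $\mathfrak{B}_p=\{(u,y)\mid(u,p,y)\in\mathfrak{B}\}$ for $p\in\mathscr{P}$. For an interval $\mathbb{T}$, $w_{\mathbb{T}}$ is the truncation of a signal $w$ to $\mathbb{T}$; $\mathfrak{B}|_{\mathbb{T}}$, $\mathfrak{B}_{\mathrm{IO}}|_{\mathbb{T}}$ are the sets of truncations of trajectories to $\mathbb{T}$, and $\mathscr{P}_{[1,L]}$ is the set of truncations to $[1,L]$ of elements of $\mathscr{P}$; $\mathfrak{B}_{\bar p}|_{[1,L]}$ is the set of $(u_{[1,L]},y_{[1,L]})$ with $(u_{[1,L]},\bar p_{[1,L]},y_{[1,L]})\in\mathfrak{B}|_{[1,L]}$. The order $n_\mathrm{x}$ is the minimal state dimension among all LPV state-space realizations representing $\mathfrak{B}$. **$L$-dissipativity.**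 Let $\Pi=\begin{bmatrix} Q & S \\ S^\top & R \end{bmatrix}$ with $Q=Q^\top\in\mathbb{R}^{n_\mathrm{u}\times n_\mathrm{u}}$, $S\in\mathbb{R}^{n_\mathrm{u}\times n_\mathrm{y}}$, $R=R^\top\in\mathbb{R}^{n_\mathrm{y}\times n_\mathrm{y}}$. The system is $L$-dissipative with respect to $(Q,S,R)$ if $\sum_{k=1}^{r}\begin{bmatrix} u_k \\ y_k \end{bmatrix}^\top\Pi\begin{bmatrix} u_k \\ y_k \end{bmatrix}\ge0$ for every $r\in[1,L]$ and all $(u_{[1,L]},y_{[1,L]})\in\mathfrak{B}_{\mathrm{IO}}|_{[1,L]}$ with zero initial condition, i.e. all past inputs and outputs in $w_0$ are zero (the past scheduling values then do not affect the trajectory). **Data matrices.** For a sequence $w_{[1,N]}$, $\mathcal{H}_L(w_{[1,N]})$ is the block Hankel matrix with $L$ block rows and $N-L+1$ columns whose $(i,j)$ block is $w_{i+j-1}$. Write $u^{\mathtt p}_{[1,N]}=\{p_k\otimes u_k\}_{k=1}^N$ and $y^{\mathtt p}_{[1,N]}=\{p_k\otimes y_k\}_{k=1}^N$ (with $p$ the scheduling in the data set), and for $\bar p_{[1,L]}$ let $\bar{\mathcal P}^{n}=\mathrm{blkdiag}_{i=1}^{L}(\bar p_i\otimes I_n)$. Let $V_\tau\in\mathbb{R}^{(n_\mathrm{u}+n_\mathrm{y})\tau\times(n_\mathrm{u}+n_\mathrm{y})L}$ be the selection matrix mapping the stacked vector $(\bar u_1,\dots,\bar u_L,\bar y_1,\dots,\bar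 y_L)$ to $(\bar u_1,\dots,\bar u_\tau,\bar y_1,\dots,\bar y_\tau)$. Define $$\Pi_L=\begin{bmatrix} I_L\otimes Q & I_L\otimes S \\ I_L\otimes S^\top & I_L\otimes R \end{bmatrix},\quad \Pi_H=\begin{bmatrix} \mathcal{H}_L(u_{[1,N]}) \\ \mathcal{H}_L(y_{[1,N]}) \end{bmatrix}^\top\Pi_L\begin{bmatrix} \mathcal{H}_L(u_{[1,N]}) \\ \mathcal{H}_L(y_{[1,N]}) \end{bmatrix},$$ $$F(\bar p_{[1,L]})=\begin{bmatrix} V_\tau\begin{bmatrix} \mathcal{H}_L(u_{[1,N]}) \\ \mathcal{H}_L(y_{[1,N]}) \end{bmatrix} \\ \mathcal{H}_L(u^{\mathtt p}_{[1,N]})-\bar{\mathcal P}^{n_\mathrm{u}}\mathcal{H}_L(u_{[1,N]}) \\ \mathcal{H}_L(y^{\mathtt p}_{[1,N]})-\bar{\mathcal P}^{n_\mathrm{y}}\mathcal{H}_L(y_{[1,N]}) \end{bmatrix}.$$ **Persistency of excitation.** For $\bar p_{[1,L]}\in\mathscr{P}_{[1,L]}$ let $\mathcal{N}_{\bar p}$ be the null space of the matrix formed by the last two block rows of $F(\bar p_{[1,L]})$, and let $\mathcal{S}$ be the row space of $\begin{bmatrix} \mathcal{H}_L(u_{[1,N]}) \\ \mathcal{H}_L(y_{[1,N]}) \end{bmatrix}$. For $L\ge n_\mathrm{r}$, $\mathcal{D}_N$ is persistently exciting of order $(L,n_\mathrm{x})$ if $\dim\{\mathrm{Proj}_{\mathcal{N}_{\bar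 p}}(\mathcal{S})\}=n_\mathrm{x}+n_\mathrm{u}L$ for all $\bar p_{[1,L]}\in\mathscr{P}_{[1,L]}$, where $\mathrm{Proj}_{\mathcal{N}_{\bar p}}(\mathcal{S})$ is the projection of $\mathcal{S}$ onto $\mathcal{N}_{\bar p}$ (this dimension equals that of the image of $\mathcal{N}_{\bar p}$ under the stacked Hankel matrix). By a known result (the Extended LPV Fundamental Lemma), this is equivalent to: for all $\bar p_{[1,L]}\in\mathscr{P}_{[1,L]}$, the image of $\mathcal{N}_{\bar p}$ under the stacked Hankel matrix equals $\mathfrak{B}_{\bar p}|_{[1,L]}$, i.e. for every $(\bar u_{[1,L]},\bar p_{[1,L]},\bar y_{[1,L]})\in\mathfrak{B}|_{[1,L]}$ there is $g\in\mathcal{N}_{\bar p}$ for which the stacked Hankel matrix times $g$ is the stacked vector $(\bar u_1,\dots,\bar u_L,\bar y_1,\dots,\bar y_L)$.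
   Formalization: Part (ii) additionally assumes that every admissible scheduling trajectory is the one-step shift of an admissible one (as when all trajectories in ℙ are admissible); for an arbitrary set of admissible scheduling trajectories part (ii) is false. *)

theory Defs
  imports
    "HOL-Analysis.Function_Topology"
    "HOL-Library.Poly_Mapping"
    "HOL-Computational_Algebra.Fraction_Field"
    "Jordan_Normal_Form.VS_Connect"
    "Jordan_Normal_Form.Matrix_Kernel"
begin

text \<open>Time is \<^typ>\<open>int\<close>, so that initial conditions live at times \<open>\<le> 0\<close>. A signal with time set \<open>T\<close> is an
  extensional function on \<open>T\<close>; the positive integers are \<open>{1..}\<close>.\<close>

type_synonym signal = "int \<Rightarrow> real vec"

definition trunc :: "nat \<Rightarrow> signal \<Rightarrow> signal" where
  "trunc L w = restrict w {1..int L}"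

definition signal_shift :: "signal \<Rightarrow> signal" where
  "signal_shift w = restrict (\<lambda>k. w (k + 1)) {1..}"

definition prepend :: "signal \<Rightarrow> signal \<Rightarrow> signal" where
  "prepend past w = (\<lambda>k. if k \<le> 0 then past k else w k)"

record lpv_io =
  n_u :: nat
  n_y :: nat
  n_p :: nat
  n_a :: nat
  n_b :: nat
  a_coef :: "nat \<Rightarrow> nat \<Rightarrow> real mat"
  b_coef :: "nat \<Rightarrow> nat \<Rightarrow> real mat"
  sched_set :: "real vec set"   \<comment> \<open>the set in which the scheduling takes values\<close>
  adm_sched :: "signal set"     \<comment> \<open>the admissible scheduling trajectories\<close>

definition n_r :: "lpv_io \<Rightarrow> nat" where
  "n_r sys = max (n_a sys) (n_b sys)"

text \<open>Entries of a scheduling vector are numbered from 1, entry 0 being the constant 1.\<close>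

definition sched_entry :: "real vec \<Rightarrow> nat \<Rightarrow> real" where
  "sched_entry p j = (if j = 0 then 1 else p $ (j - 1))"

definition affine_mat :: "nat \<Rightarrow> nat \<Rightarrow> nat \<Rightarrow> (nat \<Rightarrow> real mat) \<Rightarrow> real vec \<Rightarrow> real mat" where
  "affine_mat nr nc np M p = mat nr nc (\<lambda>(r, c). \<Sum>j=0..np. sched_entry p j * M j $$ (r, c))"

definition a_fun :: "lpv_io \<Rightarrow> nat \<Rightarrow> real vec \<Rightarrow> real mat" where
  "a_fun sys i = affine_mat (n_y sys) (n_y sys) (n_p sys) (a_coef sys i)"

definition b_fun :: "lpv_io \<Rightarrow> nat \<Rightarrow> real vec \<Rightarrow> real mat" where
  "b_fun sys i = affine_mat (n_y sys) (n_u sys) (n_p sys) (b_coef sys i)"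

text \<open>Initial conditions are triples of past outputs, past scheduling and past inputs.\<close>

type_synonym initial_condition = "signal \<times> signal \<times> signal"

definition initial_conditions :: "lpv_io \<Rightarrow> initial_condition set" where
  "initial_conditions sys =
     ({1 - int (n_a sys)..0} \<rightarrow>\<^sub>E carrier_vec (n_y sys)) \<times>
     ({1 - int (n_r sys)..0} \<rightarrow>\<^sub>E sched_set sys) \<times>
     ({1 - int (n_b sys)..0} \<rightarrow>\<^sub>E carrier_vec (n_u sys))"

definition zero_initial_conditions :: "lpv_io \<Rightarrow> initial_condition set" where
  "zero_initial_conditions sys = {(y\<^sub>0, p\<^sub>0, u\<^sub>0) \<in> initial_conditions sys.
     (\<forall>k\<in>{1 - int (n_a sys)..0}. y\<^sub>0 k = 0\<^sub>v (n_y sys)) \<and>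
     (\<forall>k\<in>{1 - int (n_b sys)..0}. u\<^sub>0 k = 0\<^sub>v (n_u sys))}"

fun solves :: "lpv_io \<Rightarrow> initial_condition \<Rightarrow> signal \<times> signal \<times> signal \<Rightarrow> bool" where
  "solves sys (y\<^sub>0, p\<^sub>0, u\<^sub>0) (u, p, y) \<longleftrightarrow> (\<forall>k\<ge>1.
     y k + finsum_vec TYPE(real) (n_y sys)
             (\<lambda>i. a_fun sys i (prepend p\<^sub>0 p (k - int i)) *\<^sub>v prepend y\<^sub>0 y (k - int i)) {1..n_a sys}
     = finsum_vec TYPE(real) (n_y sys)
             (\<lambda>i. b_fun sys i (prepend p\<^sub>0 p (k - int i)) *\<^sub>v prepend u\<^sub>0 u (k - int i)) {0..n_b sys})"

definition trajectories :: "lpv_io \<Rightarrow> (signal \<times> signal \<times> signal) set" where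
  "trajectories sys =
     ({1..} \<rightarrow>\<^sub>E carrier_vec (n_u sys)) \<times> adm_sched sys \<times> ({1..} \<rightarrow>\<^sub>E carrier_vec (n_y sys))"

definition behavior :: "lpv_io \<Rightarrow> (signal \<times> signal \<times> signal) set" where
  "behavior sys = {w \<in> trajectories sys. \<exists>w\<^sub>0 \<in> initial_conditions sys. solves sys w\<^sub>0 w}"

definition behavior_trunc :: "lpv_io \<Rightarrow> nat \<Rightarrow> (signal \<times> signal \<times> signal) set" where
  "behavior_trunc sys L = (\<lambda>(u, p, y). (trunc L u, trunc L p, trunc L y)) ` behavior sys"

definition adm_sched_trunc :: "lpv_io \<Rightarrow> nat \<Rightarrow> signal set" where
  "adm_sched_trunc sys L = trunc L ` adm_sched sys"

definition io_behavior_zero_trunc :: "lpv_io \<Rightarrow> nat \<Rightarrow> (signal \<times> signal) set" where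
  "io_behavior_zero_trunc sys L = (\<lambda>(u, p, y). (trunc L u, trunc L y)) `
     {w \<in> trajectories sys. \<exists>w\<^sub>0 \<in> zero_initial_conditions sys. solves sys w\<^sub>0 w}"

text \<open>The coefficients of matrix polynomials in the shift operator \<open>q\<close> are taken in the field of real
  rational functions in the entries of \<open>\<dots>, p\<^sub>k\<^sub>-\<^sub>1, p\<^sub>k, p\<^sub>k\<^sub>+\<^sub>1, \<dots>\<close>. Writing \<open>n\<close> for the number of
  entries of \<open>p\<^sub>k\<close>, the indeterminate with number \<open>t * n + (j - 1)\<close> stands for entry \<open>j\<close>
  (\<open>1 \<le> j \<le> n\<close>) of \<open>p\<^sub>k\<^sub>+\<^sub>t\<close>, so moving one step in time adds \<open>n\<close> to the number. Polynomials in \<open>q\<close> are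
  written with coefficients on the left and multiplied by the rule \<open>q f = shift(f) q\<close>.\<close>

type_synonym sched_poly = "(int \<Rightarrow>\<^sub>0 nat) \<Rightarrow>\<^sub>0 real"
type_synonym sched_rat = "sched_poly fract"

lemma inj_add_int: "inj (\<lambda>i::int. i + c)"
  by (simp add: inj_def)

lemma map_key_add_cancel:
  fixes m :: "int \<Rightarrow>\<^sub>0 nat"
  shows "Poly_Mapping.map_key (\<lambda>i. i + c) (Poly_Mapping.map_key (\<lambda>i. i + - c) m) = m"
  by (simp only: map_key_compose[OF inj_add_int inj_add_int] comp_def add.assoc
        add.right_inverse add_0_right map_key_id)

lemma inj_map_key_add: "inj (\<lambda>m :: int \<Rightarrow>\<^sub>0 nat. Poly_Mapping.map_key (\<lambda>i. i + c) m)"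
  using map_key_add_cancel[of "- c"] by (intro inj_on_inverseI) simp

text \<open>Precomposing exponents with \<open>\<lambda>i. i + n\<close>, twice contravariantly, replaces indeterminate \<open>i\<close> by
  indeterminate \<open>i + n\<close>; see \<open>shift_poly_indet\<close> below.\<close>

definition shift_poly :: "nat \<Rightarrow> sched_poly \<Rightarrow> sched_poly" where
  "shift_poly n = Poly_Mapping.map_key (Poly_Mapping.map_key (\<lambda>i. i + int n))"

lemma shift_poly_single:
  "shift_poly n (Poly_Mapping.single m c) =
     Poly_Mapping.single (Poly_Mapping.map_key (\<lambda>i. i + - int n) m) c"
  unfolding shift_poly_def
  using map_key_single[OF inj_map_key_add, of "int n" "Poly_Mapping.map_key (\<lambda>i. i + - int n) m" c]
  by (simp only: map_key_add_cancel)

lemma shift_poly_indet: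
  "shift_poly n (Poly_Mapping.single (Poly_Mapping.single i 1) c) =
     Poly_Mapping.single (Poly_Mapping.single (i + int n) 1) c"
  using map_key_single[OF inj_add_int[of "- int n"], of "i + int n" "1::nat"]
  by (simp add: shift_poly_single)

lemma shift_poly_zero: "shift_poly n 0 = 0"
  unfolding shift_poly_def by (rule map_key_zero[OF inj_map_key_add])

lemma shift_poly_plus: "shift_poly n (f + g) = shift_poly n f + shift_poly n g"
  unfolding shift_poly_def by (rule map_key_plus[OF inj_map_key_add])

lemma update_eq_single_plus:
  "a \<notin> Poly_Mapping.keys h \<Longrightarrow> Poly_Mapping.update a b h = Poly_Mapping.single a b + h"
  for h :: "'a \<Rightarrow>\<^sub>0 'b::monoid_add"
  by (intro poly_mapping_eqI) (simp add: lookup_add lookup_single update.rep_eq in_keys_iff when_def)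

lemma shift_poly_mult: "shift_poly n (f * g) = shift_poly n f * shift_poly n g"
proof (induction f rule: update_induct)
  case upd: (update f a b)
  have "shift_poly n (Poly_Mapping.single a b * g) =
      shift_poly n (Poly_Mapping.single a b) * shift_poly n g"
  proof (induction g rule: update_induct)
    case (update g c d)
    then show ?case
      by (simp only: update_eq_single_plus[OF update(1)] distrib_left shift_poly_plus mult_single
          shift_poly_single map_key_plus[OF inj_add_int])
  qed (simp add: shift_poly_zero)
  with upd show ?case
    by (simp only: update_eq_single_plus[OF upd(1)] distrib_right shift_poly_plus)
qed (simp add: shift_poly_zero)

lemma shift_poly_eq_0_iff: "shift_poly n f = 0 \<longleftrightarrow> f = 0"
proof (induction f rule: update_induct)
  case (update f a b)
  have "Poly_Mapping.lookup (shift_poly n (Poly_Mapping.update a b f))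
      (Poly_Mapping.map_key (\<lambda>i. i + - int n) a) = b"
    unfolding shift_poly_def
    by (simp only: map_key.rep_eq[OF inj_map_key_add] comp_def map_key_add_cancel update.rep_eq fun_upd_same)
  moreover have "Poly_Mapping.lookup (Poly_Mapping.update a b f) a = b"
    by (simp add: update.rep_eq)
  ultimately show ?case
    using update(2) by (metis lookup_zero)
qed (simp add: shift_poly_zero)

definition shift_rat :: "nat \<Rightarrow> sched_rat \<Rightarrow> sched_rat" where
  "shift_rat n r = (THE s. \<exists>f g. g \<noteq> 0 \<and> r = Fract f g \<and> s = Fract (shift_poly n f) (shift_poly n g))"

lemma shift_rat_Fract:
  assumes "g \<noteq> 0"
  shows "shift_rat n (Fract f g) = Fract (shift_poly n f) (shift_poly n g)"
  unfolding shift_rat_def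
proof (rule the_equality)
  fix s
  assume "\<exists>f' g'. g' \<noteq> 0 \<and> Fract f g = Fract f' g' \<and> s = Fract (shift_poly n f') (shift_poly n g')"
  then obtain f' g' where *: "g' \<noteq> 0" "Fract f g = Fract f' g'" and
    s: "s = Fract (shift_poly n f') (shift_poly n g')" by blast
  from * assms have "f * g' = f' * g" by (simp add: eq_fract)
  then have "shift_poly n f * shift_poly n g' = shift_poly n f' * shift_poly n g"
    by (simp only: flip: shift_poly_mult)
  with * assms show "s = Fract (shift_poly n f) (shift_poly n g)"
    by (simp add: s eq_fract shift_poly_eq_0_iff)
qed (use assms in blast)

definition sched_const :: "real \<Rightarrow> sched_rat" where
  "sched_const c = Fract (Poly_Mapping.single 0 c) 1"

text \<open>Entry \<open>j\<close> of \<open>p\<^sub>k\<^sub>+\<^sub>t\<close> as an indeterminate, with entry 0 being the constant 1 again.\<close>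

definition sched_indet :: "nat \<Rightarrow> nat \<Rightarrow> nat \<Rightarrow> sched_rat" where
  "sched_indet n t j = (if j = 0 then 1
     else Fract (Poly_Mapping.single (Poly_Mapping.single (int (t * n + (j - 1))) 1) 1) 1)"

definition skew_mult :: "nat \<Rightarrow> sched_rat poly \<Rightarrow> sched_rat poly \<Rightarrow> sched_rat poly" where
  "skew_mult n f g = (\<Sum>i\<le>degree f. \<Sum>j\<le>degree g.
     monom (coeff f i * (shift_rat n ^^ i) (coeff g j)) (i + j))"

definition skew_mat_mult ::
    "nat \<Rightarrow> sched_rat poly mat \<Rightarrow> sched_rat poly mat \<Rightarrow> sched_rat poly mat" where
  "skew_mat_mult n A B = mat (dim_row A) (dim_col B)
     (\<lambda>(i, j). \<Sum>k<dim_col A. skew_mult n (A $$ (i, k)) (B $$ (k, j)))"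

definition skew_unimodular :: "nat \<Rightarrow> nat \<Rightarrow> sched_rat poly mat \<Rightarrow> bool" where
  "skew_unimodular n m U \<longleftrightarrow> U \<in> carrier_mat m m \<and>
     (\<exists>V \<in> carrier_mat m m. skew_mat_mult n U V = 1\<^sub>m m \<and> skew_mat_mult n V U = 1\<^sub>m m)"

definition left_coprime ::
    "nat \<Rightarrow> nat \<Rightarrow> nat \<Rightarrow> sched_rat poly mat \<Rightarrow> sched_rat poly mat \<Rightarrow> bool" where
  "left_coprime n ny nu A B \<longleftrightarrow>
     (\<forall>D \<in> carrier_mat ny ny. \<forall>A' \<in> carrier_mat ny ny. \<forall>B' \<in> carrier_mat ny nu.
        A = skew_mat_mult n D A' \<and> B = skew_mat_mult n D B' \<longrightarrow> skew_unimodular n ny D)"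

definition skew_full_row_rank ::
    "nat \<Rightarrow> nat \<Rightarrow> nat \<Rightarrow> sched_rat poly mat \<Rightarrow> sched_rat poly mat \<Rightarrow> bool" where
  "skew_full_row_rank n ny nu A B \<longleftrightarrow>
     (\<forall>x \<in> carrier_mat 1 ny.
        skew_mat_mult n x A = 0\<^sub>m 1 ny \<and> skew_mat_mult n x B = 0\<^sub>m 1 nu \<longrightarrow> x = 0\<^sub>m 1 ny)"

definition coef_indet ::
    "lpv_io \<Rightarrow> (nat \<Rightarrow> real mat) \<Rightarrow> nat \<Rightarrow> nat \<Rightarrow> nat \<Rightarrow> sched_rat" where
  "coef_indet sys M t r c =
     (\<Sum>j=0..n_p sys. sched_indet (n_p sys) t j * sched_const (M j $$ (r, c)))"

text \<open>Multiplying \<open>a\<^sub>i(p\<^sub>k\<^sub>-\<^sub>i) q\<^sup>-\<^sup>i\<close> by \<open>q\<close> to the power \<open>n\<^sub>r\<close> from the left gives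
  \<open>a\<^sub>i\<close>, evaluated \<open>n\<^sub>r - i\<close> steps ahead of \<open>p\<^sub>k\<close>, times \<open>q\<close> to the power \<open>n\<^sub>r - i\<close>.\<close>

definition a_polynomial :: "lpv_io \<Rightarrow> sched_rat poly mat" where
  "a_polynomial sys = mat (n_y sys) (n_y sys) (\<lambda>(r, c).
     (if r = c then monom 1 (n_r sys) else 0) +
     (\<Sum>i=1..n_a sys. monom (coef_indet sys (a_coef sys i) (n_r sys - i) r c) (n_r sys - i)))"

definition b_polynomial :: "lpv_io \<Rightarrow> sched_rat poly mat" where
  "b_polynomial sys = mat (n_y sys) (n_u sys) (\<lambda>(r, c).
     \<Sum>i=0..n_b sys. monom (coef_indet sys (b_coef sys i) (n_r sys - i) r c) (n_r sys - i))"

definition minimal_representation :: "lpv_io \<Rightarrow> bool" where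
  "minimal_representation sys \<longleftrightarrow>
     left_coprime (n_p sys) (n_y sys) (n_u sys) (a_polynomial sys) (b_polynomial sys) \<and>
     skew_full_row_rank (n_p sys) (n_y sys) (n_u sys) (a_polynomial sys) (b_polynomial sys)"

definition vec_convex :: "real vec set \<Rightarrow> bool" where
  "vec_convex P \<longleftrightarrow> (\<forall>v\<in>P. \<forall>w\<in>P. \<forall>t\<in>{0..1}. (1 - t) \<cdot>\<^sub>v v + t \<cdot>\<^sub>v w \<in> P)"

text \<open>\<^typ>\<open>real vec\<close> carries no topology; padding with zeros embeds \<open>\<real>\<^sup>n\<close> as a closed subspace of the
  product space \<^typ>\<open>nat \<Rightarrow> real\<close>.\<close>

definition vec_compact :: "nat \<Rightarrow> real vec set \<Rightarrow> bool" where
  "vec_compact n P \<longleftrightarrow> compact ((\<lambda>v i. if i < n then v $ i else 0) ` P)"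

definition lpv_system :: "lpv_io \<Rightarrow> bool" where
  "lpv_system sys \<longleftrightarrow>
     1 \<le> n_a sys \<and>
     (\<forall>i\<in>{1..n_a sys}. \<forall>j\<in>{0..n_p sys}. a_coef sys i j \<in> carrier_mat (n_y sys) (n_y sys)) \<and>
     (\<forall>i\<in>{0..n_b sys}. \<forall>j\<in>{0..n_p sys}. b_coef sys i j \<in> carrier_mat (n_y sys) (n_u sys)) \<and>
     sched_set sys \<subseteq> carrier_vec (n_p sys) \<and>
     vec_convex (sched_set sys) \<and> vec_compact (n_p sys) (sched_set sys) \<and>
     adm_sched sys \<subseteq> ({1..} \<rightarrow>\<^sub>E sched_set sys) \<and>
     minimal_representation sys"

text \<open>The state-space matrices may be arbitrary functions of the current scheduling value.\<close>

definition ss_behavior :: "lpv_io \<Rightarrow> nat \<Rightarrow>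
    (real vec \<Rightarrow> real mat) \<Rightarrow> (real vec \<Rightarrow> real mat) \<Rightarrow> (real vec \<Rightarrow> real mat) \<Rightarrow> (real vec \<Rightarrow> real mat) \<Rightarrow>
    (signal \<times> signal \<times> signal) set" where
  "ss_behavior sys n A B C D = {(u, p, y) \<in> trajectories sys.
     \<exists>x \<in> {1..} \<rightarrow>\<^sub>E carrier_vec n. \<forall>k\<ge>1.
       x (k + 1) = A (p k) *\<^sub>v x k + B (p k) *\<^sub>v u k \<and>
       y k = C (p k) *\<^sub>v x k + D (p k) *\<^sub>v u k}"

definition has_ss_realization :: "lpv_io \<Rightarrow> nat \<Rightarrow> bool" where
  "has_ss_realization sys n \<longleftrightarrow>
     (\<exists>A \<in> sched_set sys \<rightarrow> carrier_mat n n.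
      \<exists>B \<in> sched_set sys \<rightarrow> carrier_mat n (n_u sys).
      \<exists>C \<in> sched_set sys \<rightarrow> carrier_mat (n_y sys) n.
      \<exists>D \<in> sched_set sys \<rightarrow> carrier_mat (n_y sys) (n_u sys).
        ss_behavior sys n A B C D = behavior sys)"

definition is_order :: "lpv_io \<Rightarrow> nat \<Rightarrow> bool" where
  "is_order sys n \<longleftrightarrow> has_ss_realization sys n \<and> (\<forall>m. has_ss_realization sys m \<longrightarrow> n \<le> m)"

definition supply_matrix :: "real mat \<Rightarrow> real mat \<Rightarrow> real mat \<Rightarrow> real mat" where
  "supply_matrix Q S R = four_block_mat Q S (transpose_mat S) R"

definition supply_rate :: "real mat \<Rightarrow> real mat \<Rightarrow> real mat \<Rightarrow> real vec \<Rightarrow> real vec \<Rightarrow> real" where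
  "supply_rate Q S R u y = (u @\<^sub>v y) \<bullet> (supply_matrix Q S R *\<^sub>v (u @\<^sub>v y))"

definition dissipative :: "lpv_io \<Rightarrow> nat \<Rightarrow> real mat \<Rightarrow> real mat \<Rightarrow> real mat \<Rightarrow> bool" where
  "dissipative sys L Q S R \<longleftrightarrow>
     (\<forall>r\<in>{1..L}. \<forall>(u, y) \<in> io_behavior_zero_trunc sys L. (\<Sum>k=1..int r. supply_rate Q S R (u k) (y k)) \<ge> 0)"

definition kron_mat :: "real mat \<Rightarrow> real mat \<Rightarrow> real mat" where
  "kron_mat A B = mat (dim_row A * dim_row B) (dim_col A * dim_col B) (\<lambda>(i, j).
     A $$ (i div dim_row B, j div dim_col B) * B $$ (i mod dim_row B, j mod dim_col B))"

definition kron_vec :: "real vec \<Rightarrow> real vec \<Rightarrow> real vec" where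
  "kron_vec v w = vec (dim_vec v * dim_vec w) (\<lambda>i. v $ (i div dim_vec w) * w $ (i mod dim_vec w))"

text \<open>Rows and columns of matrices are numbered from 0, so block row \<open>r div d\<close> of column \<open>c\<close> is
  \<open>w (r div d + c + 1)\<close>.\<close>

definition hankel :: "nat \<Rightarrow> nat \<Rightarrow> nat \<Rightarrow> signal \<Rightarrow> real mat" where
  "hankel d L N w = mat (L * d) (N - L + 1) (\<lambda>(r, c). w (int (r div d + c + 1)) $ (r mod d))"

definition stacked_hankel :: "lpv_io \<Rightarrow> nat \<Rightarrow> nat \<Rightarrow> signal \<Rightarrow> signal \<Rightarrow> real mat" where
  "stacked_hankel sys L N u y = hankel (n_u sys) L N u @\<^sub>r hankel (n_y sys) L N y"

definition sched_block_diag :: "nat \<Rightarrow> nat \<Rightarrow> signal \<Rightarrow> real mat" where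
  "sched_block_diag d L p =
     diag_block_mat (map (\<lambda>i. kron_mat (mat_of_cols (dim_vec (p (int i))) [p (int i)]) (1\<^sub>m d)) [1..<L + 1])"

definition sched_rows :: "lpv_io \<Rightarrow> nat \<Rightarrow> nat \<Rightarrow> signal \<Rightarrow> signal \<Rightarrow> signal \<Rightarrow> signal \<Rightarrow> real mat" where
  "sched_rows sys L N u p y pbar =
     (hankel (n_p sys * n_u sys) L N (\<lambda>k. kron_vec (p k) (u k))
        - sched_block_diag (n_u sys) L pbar * hankel (n_u sys) L N u) @\<^sub>r
     (hankel (n_p sys * n_y sys) L N (\<lambda>k. kron_vec (p k) (y k))
        - sched_block_diag (n_y sys) L pbar * hankel (n_y sys) L N y)"

definition head_select :: "nat \<Rightarrow> nat \<Rightarrow> nat \<Rightarrow> real mat" where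
  "head_select d \<tau> L = mat (d * \<tau>) (d * L) (\<lambda>(i, j). if i = j then 1 else 0)"

definition V_mat :: "lpv_io \<Rightarrow> nat \<Rightarrow> nat \<Rightarrow> real mat" where
  "V_mat sys \<tau> L = diag_block_mat [head_select (n_u sys) \<tau> L, head_select (n_y sys) \<tau> L]"

definition F_mat :: "lpv_io \<Rightarrow> nat \<Rightarrow> nat \<Rightarrow> nat \<Rightarrow> signal \<Rightarrow> signal \<Rightarrow> signal \<Rightarrow> signal \<Rightarrow> real mat" where
  "F_mat sys \<tau> L N u p y pbar =
     (V_mat sys \<tau> L * stacked_hankel sys L N u y) @\<^sub>r sched_rows sys L N u p y pbar"

definition Pi_L :: "nat \<Rightarrow> real mat \<Rightarrow> real mat \<Rightarrow> real mat \<Rightarrow> real mat" where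
  "Pi_L L Q S R = four_block_mat
     (kron_mat (1\<^sub>m L) Q) (kron_mat (1\<^sub>m L) S)
     (kron_mat (1\<^sub>m L) (transpose_mat S)) (kron_mat (1\<^sub>m L) R)"

definition Pi_H :: "lpv_io \<Rightarrow> nat \<Rightarrow> nat \<Rightarrow> signal \<Rightarrow> signal \<Rightarrow> real mat \<Rightarrow> real mat \<Rightarrow> real mat \<Rightarrow> real mat" where
  "Pi_H sys L N u y Q S R =
     transpose_mat (stacked_hankel sys L N u y) * Pi_L L Q S R * stacked_hankel sys L N u y"

definition data_condition :: "lpv_io \<Rightarrow> nat \<Rightarrow> nat \<Rightarrow> nat \<Rightarrow> signal \<Rightarrow> signal \<Rightarrow> signal \<Rightarrow>
    real mat \<Rightarrow> real mat \<Rightarrow> real mat \<Rightarrow> signal \<Rightarrow> bool" where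
  "data_condition sys \<tau> L N u p y Q S R pbar \<longleftrightarrow>
     (\<forall>g \<in> carrier_vec (N - L + 1).
        F_mat sys \<tau> L N u p y pbar *\<^sub>v g = 0\<^sub>v (dim_row (F_mat sys \<tau> L N u p y pbar)) \<longrightarrow>
        g \<bullet> (Pi_H sys L N u y Q S R *\<^sub>v g) \<ge> 0)"

definition orth_proj_set :: "real vec set \<Rightarrow> real vec set \<Rightarrow> real vec set" where
  "orth_proj_set W X = {v \<in> W. \<exists>s\<in>X. \<forall>w\<in>W. (s - v) \<bullet> w = 0}"

definition subspace_dim :: "nat \<Rightarrow> real vec set \<Rightarrow> nat" where
  "subspace_dim n W = vectorspace.dim class_ring (module_vec TYPE(real) n\<lparr>carrier := W\<rparr>)"

definition persistently_exciting :: "lpv_io \<Rightarrow> nat \<Rightarrow> nat \<Rightarrow> nat \<Rightarrow> signal \<Rightarrow> signal \<Rightarrow> signal \<Rightarrow> bool" where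
  "persistently_exciting sys L n N u p y \<longleftrightarrow>
     n_r sys \<le> L \<and>
     (\<forall>pbar \<in> adm_sched_trunc sys L.
        subspace_dim (N - L + 1)
          (orth_proj_set (mat_kernel (sched_rows sys L N u p y pbar))
             (vec_space.row_space (N - L + 1) (stacked_hankel sys L N u y)))
        = n + n_u sys * L)"

end

theory Submission
  imports Defs
begin

text \<open>A vector \<open>g\<close> combines the length-\<open>L\<close> windows of the data into a pair \<open>(u, y)\<close>, and \<open>g\<^sup>T \<Pi>\<^sub>H g\<close> is the
  supply accumulated along it. The last two block rows of \<open>F\<close> say that the products of the data
  scheduling with the data combine as if the scheduling were the given one, so the combination
  satisfies the affine difference equation with that scheduling wherever no past value enters.

  For (i), if the combination vanishes on the first \<open>\<tau> \<ge> n\<^sub>r\<close> steps, no past value enters at all: it is a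
  zero initial condition trajectory.

  For (ii), fix the scheduling. Restarting each window from its own past under this
  scheduling gives trajectories, and a state-space realization makes trajectories with a common
  scheduling a linear space; hence combinations from the kernel are trajectories. These have at
  most \<open>n\<^sub>x + n\<^sub>u L\<close> dimensions, which persistency of excitation fills, so every trajectory is such a
  combination. A zero initial condition trajectory of length \<open>r \<le> L - \<tau>\<close> is then delayed by
  \<open>L - r \<ge> \<tau>\<close> steps and tested against the data condition.\<close>

section \<open>Subspaces and orthogonal projections\<close>

text \<open>Closure conditions in elementary form, checkable by vector arithmetic. They are
  translated to the algebraic notion of a submodule only where the dimension is unfolded.\<close>

definition vec_subspace :: "nat \<Rightarrow> real vec set \<Rightarrow> bool" where
  "vec_subspace n W \<longleftrightarrow> W \<subseteq> carrier_vec n \<and> 0\<^sub>v n \<in> W \<and> (\<forall>v\<in>W. \<forall>w\<in>W. v + w \<in> W) \<and>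
     (\<forall>c. \<forall>v\<in>W. c \<cdot>\<^sub>v v \<in> W)"

lemma vec_subspaceD:
  assumes "vec_subspace n W"
  shows "W \<subseteq> carrier_vec n" "0\<^sub>v n \<in> W"
    "v \<in> W \<Longrightarrow> w \<in> W \<Longrightarrow> v + w \<in> W" "v \<in> W \<Longrightarrow> c \<cdot>\<^sub>v v \<in> W"
  using assms by (auto simp: vec_subspace_def)

text \<open>Takes the columns of \<open>V\<close> to be a basis of \<open>W\<close>, so that the
  abstract dimension becomes the width of a matrix with trivial kernel and later arguments are
  matrix algebra.\<close>

lemma subspace_dim_obtain_basis_mat:
  assumes W: "vec_subspace n W"
  obtains V where "V \<in> carrier_mat n (subspace_dim n W)"
    "\<And>c. c \<in> carrier_vec (subspace_dim n W) \<Longrightarrow> V *\<^sub>v c \<in> W"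
    "\<And>c. c \<in> carrier_vec (subspace_dim n W) \<Longrightarrow> V *\<^sub>v c = 0\<^sub>v n \<Longrightarrow> c = 0\<^sub>v (subspace_dim n W)"
proof -
  interpret V: vec_space "TYPE(real)" n .
  have subm: "submodule class_ring W V.V"
    using vec_subspaceD[OF W] by (unfold_locales) (auto simp: module_vec_simps class_ring_simps)
  have vsW: "vectorspace class_ring (V.vs W)"
    using V.submodule_is_module[OF subm] V.subspace_is_vs subm V.vectorspace_axioms
    by (simp add: VectorSpace.subspace_def)
  interpret W: vectorspace class_ring "V.vs W" by (rule vsW)
  note sub = vec_subspaceD(1)[OF W]
  let ?P = "\<lambda>B. B \<subseteq> carrier (V.vs W) \<and> W.lin_indpt B"
  \<comment> \<open>A set that is independent inside \<open>W\<close> is independent in the whole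
    space and so has at most \<open>n\<close> elements. This bound is what makes a maximal
    independent set exist.\<close>
  have bound: "finite B \<and> card B \<le> n" if "?P B" for B
  proof -
    from that have "B \<subseteq> W" and "V.lin_indpt B"
      using V.span_li_not_depend(2)[OF _ subm] by auto
    then show ?thesis using V.li_le_dim[of B] sub V.dim_is_n by (simp add: module_vec_simps subset_trans)
  qed
  have "?P {}" by (simp add: W.lin_dep_def)
  from maximal_exists[of ?P, OF bound this] obtain B where B: "finite B" "maximal B ?P" by blast
  have basis: "W.basis B" by (rule W.max_li_is_basis[OF B(2)])
  have card: "subspace_dim n W = card B"
    unfolding subspace_dim_def using W.dim_basis[OF B(1) basis] by simp
  from B have BW: "B \<subseteq> W" and li: "V.lin_indpt B"
    using V.span_li_not_depend(2)[OF _ subm] by (auto simp: maximal_def)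
  from BW sub have BC: "B \<subseteq> carrier_vec n" by auto
  obtain ws where ws: "set ws = B" "distinct ws" using B(1) finite_distinct_list by blast
  have len: "length ws = card B" using ws distinct_card by metis
  let ?V = "mat_of_cols n ws"
  \<comment> \<open>\<open>lincomb\<close> weights the elements of a set, whereas a matrix weights
    positions. The enumeration \<open>ws\<close> is distinct, so each vector determines its position
    and hence its coefficient.\<close>
  have comb: "?V *\<^sub>v c = V.lincomb (\<lambda>w. c $ (THE i. i < length ws \<and> ws ! i = w)) B"
    if c: "c \<in> carrier_vec (card B)" for c
  proof -
    let ?f = "\<lambda>w. c $ (THE i. i < length ws \<and> ws ! i = w)"
    have idx: "?f (ws ! i) = c $ i" if "i < length ws" for i
    proof -
      have "(THE j. j < length ws \<and> ws ! j = ws ! i) = i"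
        using that ws(2) by (intro the_equality) (auto simp: nth_eq_iff_index_eq)
      then show ?thesis by simp
    qed
    have "V.lincomb ?f B = V.lincomb_list (\<lambda>i. ?f (ws ! i)) ws"
      using V.lincomb_as_lincomb_list_distinct[of ws ?f] ws BC by auto
    also have "\<dots> = ?V *\<^sub>v vec (length ws) (\<lambda>i. ?f (ws ! i))"
      using ws BC by (intro V.lincomb_list_as_mat_mult) auto
    also have "vec (length ws) (\<lambda>i. ?f (ws ! i)) = c"
      using c len idx by (intro eq_vecI) auto
    finally show ?thesis by simp
  qed
  show ?thesis
  proof (rule that[of ?V])
    show "?V \<in> carrier_mat n (subspace_dim n W)" using len card mat_of_cols_carrier(1)[of n ws] by simp
  next
    fix c :: "real vec" assume "c \<in> carrier_vec (subspace_dim n W)"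
    then have c: "c \<in> carrier_vec (card B)" by (simp add: card)
    have "V.lincomb a B \<in> V.span B" for a
      using V.finite_span[OF B(1)] BC by (auto simp: module_vec_simps class_ring_simps)
    then show "?V *\<^sub>v c \<in> W" using comb[OF c] V.span_is_subset[OF BW subm] by auto
    assume "?V *\<^sub>v c = 0\<^sub>v n"
    then have z: "V.lincomb (\<lambda>w. c $ (THE i. i < length ws \<and> ws ! i = w)) B = 0\<^sub>v n"
      using comb[OF c] by simp
    have "c $ i = 0" if i: "i < card B" for i
    proof (rule ccontr)
      assume "c $ i \<noteq> 0"
      moreover have "(THE j. j < length ws \<and> ws ! j = ws ! i) = i"
        using i len ws(2) by (intro the_equality) (auto simp: nth_eq_iff_index_eq)
      moreover have "ws ! i \<in> B" using ws(1) i len by auto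
      ultimately have "V.lin_dep B"
        using z B(1) V.lin_dep_crit[where A = B and S = B and v = "ws ! i"
            and a = "\<lambda>w. c $ (THE i. i < length ws \<and> ws ! i = w)"] by (auto simp: module_vec_simps class_ring_simps)
      with li show False by simp
    qed
    with c card show "c = 0\<^sub>v (subspace_dim n W)" by (intro eq_vecI) auto
  qed
qed

text \<open>The orthogonality that defines the projection is linear in the pair of vector and
  preimage, so preimages are added and scaled alongside.\<close>

lemma vec_subspace_orth_proj_set:
  assumes "vec_subspace n W" "vec_subspace n X"
  shows "vec_subspace n (orth_proj_set W X)"
proof -
  note W = vec_subspaceD[OF assms(1)] and X = vec_subspaceD[OF assms(2)]
  have "0\<^sub>v n \<in> orth_proj_set W X"
    using W X by (auto simp: orth_proj_set_def intro!: bexI[of _ "0\<^sub>v n"])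
  moreover have "v + w \<in> orth_proj_set W X" if vw: "v \<in> orth_proj_set W X" "w \<in> orth_proj_set W X" for v w
  proof -
    from vw obtain s t where st: "s \<in> X" "t \<in> X"
      and s: "\<And>x. x \<in> W \<Longrightarrow> (s - v) \<bullet> x = 0" and t: "\<And>x. x \<in> W \<Longrightarrow> (t - w) \<bullet> x = 0"
      by (auto simp: orth_proj_set_def)
    have vw': "v \<in> W" "w \<in> W" using vw by (auto simp: orth_proj_set_def)
    have c: "v \<in> carrier_vec n" "w \<in> carrier_vec n" "s \<in> carrier_vec n" "t \<in> carrier_vec n"
      using vw' st W X by auto
    have e: "(s + t) - (v + w) = (s - v) + (t - w)" using c by (intro eq_vecI) auto
    have "((s + t) - (v + w)) \<bullet> x = 0" if "x \<in> W" for x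
      unfolding e using c that W(1) s t by (subst add_scalar_prod_distrib[of _ n]) auto
    then show ?thesis using vw' st W X by (auto simp: orth_proj_set_def intro!: bexI[of _ "s + t"])
  qed
  moreover have "c \<cdot>\<^sub>v v \<in> orth_proj_set W X" if v: "v \<in> orth_proj_set W X" for c v
  proof -
    from v obtain s where sX: "s \<in> X" and s: "\<And>x. x \<in> W \<Longrightarrow> (s - v) \<bullet> x = 0"
      by (auto simp: orth_proj_set_def)
    have v': "v \<in> W" using v by (auto simp: orth_proj_set_def)
    have c: "v \<in> carrier_vec n" "s \<in> carrier_vec n" using v' sX W X by auto
    have e: "c \<cdot>\<^sub>v s - c \<cdot>\<^sub>v v = c \<cdot>\<^sub>v (s - v)" using c by (intro eq_vecI) (auto simp: algebra_simps)
    have "(c \<cdot>\<^sub>v s - c \<cdot>\<^sub>v v) \<bullet> x = 0" if "x \<in> W" for x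
      unfolding e using c that W(1) s by (subst smult_scalar_prod_distrib[of _ n]) auto
    then show ?thesis using v' sX W X by (auto simp: orth_proj_set_def intro!: bexI[of _ "c \<cdot>\<^sub>v s"])
  qed
  moreover have "orth_proj_set W X \<subseteq> carrier_vec n" using W(1) by (auto simp: orth_proj_set_def)
  ultimately show ?thesis unfolding vec_subspace_def by blast
qed

lemma vec_subspace_mat_kernel:
  assumes A: "A \<in> carrier_mat nr nc"
  shows "vec_subspace nc (mat_kernel A)"
  unfolding vec_subspace_def using A mat_kernel_smult[OF A]
  by (auto simp: mat_kernel[OF A] mult_add_distrib_mat_vec[OF A])

text \<open>The row space is treated as the image of the transpose, where closure is linearity of
  the product.\<close>

lemma vec_subspace_row_space:
  assumes A: "A \<in> carrier_mat nr nc"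
  shows "vec_subspace nc (vec_space.row_space nc A)"
proof -
  interpret V: vec_space "TYPE(real)" nc .
  have X: "V.row_space A = {w\<in>carrier_vec nc. \<exists>y\<in>carrier_vec nr. A\<^sup>T *\<^sub>v y = w}"
    using V.row_space_eq[OF A] A by auto
  have At: "A\<^sup>T \<in> carrier_mat nc nr" using A by simp
  have "0\<^sub>v nc \<in> V.row_space A" using At by (auto simp: X intro!: bexI[of _ "0\<^sub>v nr"])
  moreover have "v + w \<in> V.row_space A" if "v \<in> V.row_space A" "w \<in> V.row_space A" for v w
  proof -
    from that obtain y z where yz: "y \<in> carrier_vec nr" "z \<in> carrier_vec nr" "v = A\<^sup>T *\<^sub>v y" "w = A\<^sup>T *\<^sub>v z"
      by (auto simp: X)
    have "v + w = A\<^sup>T *\<^sub>v (y + z)" using yz mult_add_distrib_mat_vec[OF At] by simp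
    moreover have "v + w \<in> carrier_vec nc" using that by (auto simp: X)
    ultimately show ?thesis using yz by (auto simp: X)
  qed
  moreover have "c \<cdot>\<^sub>v v \<in> V.row_space A" if "v \<in> V.row_space A" for c v
  proof -
    from that obtain y where y: "y \<in> carrier_vec nr" "v = A\<^sup>T *\<^sub>v y"
      by (auto simp: X)
    have "c \<cdot>\<^sub>v v = A\<^sup>T *\<^sub>v (c \<cdot>\<^sub>v y)" using y mult_mat_vec[OF At] by simp
    moreover have "c \<cdot>\<^sub>v v \<in> carrier_vec nc" using that by (auto simp: X)
    ultimately show ?thesis using y by (auto simp: X)
  qed
  moreover have "V.row_space A \<subseteq> carrier_vec nc" by (auto simp: X)
  ultimately show ?thesis unfolding vec_subspace_def by blast
qed

text \<open>On the projection of the row space onto any subspace \<open>W\<close> the matrix is injective: a vector of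
  \<open>W\<close> annihilated by \<open>A\<close> is orthogonal to the row space, hence to its own preimage.\<close>

lemma orth_proj_row_space_inj:
  assumes A: "A \<in> carrier_mat nr nc" and W: "W \<subseteq> carrier_vec nc"
    and v: "v \<in> orth_proj_set W (vec_space.row_space nc A)" and Av: "A *\<^sub>v v = 0\<^sub>v nr"
  shows "v = 0\<^sub>v nc"
proof -
  interpret V: vec_space "TYPE(real)" nc .
  from v obtain s where vW: "v \<in> W" and s: "s \<in> V.row_space A" and orth: "(s - v) \<bullet> v = 0"
    by (auto simp: orth_proj_set_def)
  from s obtain y where y: "y \<in> carrier_vec nr" "s = A\<^sup>T *\<^sub>v y"
    using V.row_space_eq[OF A] A by auto
  have vc: "v \<in> carrier_vec nc" using vW W by auto
  have "s \<bullet> v = y \<bullet> (A *\<^sub>v v)"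
    using transpose_vec_mult_scalar[OF A vc y(1)] y A vc
    by (metis comm_scalar_prod transpose_carrier_mat mult_mat_vec_carrier)
  then have "s \<bullet> v = 0" using Av y by simp
  moreover have "s \<in> carrier_vec nc" using y A by simp
  ultimately have "v \<bullet> v = 0" using orth vc minus_scalar_prod_distrib[of s nc v v] by simp
  then show ?thesis using vc conjugate_square_eq_0_vec[of v nc] by (simp add: scalar_prod_def)
qed

text \<open>A trivial kernel makes the determinant nonzero; the inverse then produces the
  preimage.\<close>

lemma mat_surj_if_trivial_kernel:
  fixes Z :: "real mat"
  assumes Z: "Z \<in> carrier_mat d d" and ker: "\<And>c. c \<in> carrier_vec d \<Longrightarrow> Z *\<^sub>v c = 0\<^sub>v d \<Longrightarrow> c = 0\<^sub>v d"
    and z: "z \<in> carrier_vec d"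
  obtains c where "c \<in> carrier_vec d" "Z *\<^sub>v c = z"
proof -
  have "det Z \<noteq> 0" using det_0_iff_vec_prod_zero[OF Z] ker by blast
  then obtain B where B: "B \<in> carrier_mat d d" "Z * B = 1\<^sub>m d"
    using det_non_zero_imp_unit[OF Z] by (auto simp: Units_def ring_mat_def)
  show ?thesis
    using B Z z assoc_mult_mat_vec[OF Z B(1) z] by (intro that[of "B *\<^sub>v z"]) auto
qed

section \<open>Block Hankel matrices\<close>

text \<open>Entrywise real sums instead of sums of vectors: the result lies in
  \<open>carrier_vec d\<close> whatever the signals are, and interchanging sums is an identity
  between reals.\<close>

definition sig_comb :: "nat \<Rightarrow> 'a set \<Rightarrow> ('a \<Rightarrow> real) \<Rightarrow> ('a \<Rightarrow> signal) \<Rightarrow> signal" where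
  "sig_comb d J c w = (\<lambda>k. vec d (\<lambda>i. \<Sum>q\<in>J. c q * w q k $ i))"

text \<open>Rows count from 0 and time from 1, as in \<open>hankel\<close>: block row 0 holds
  \<open>w 1\<close>.\<close>

definition stack :: "nat \<Rightarrow> nat \<Rightarrow> signal \<Rightarrow> real vec" where
  "stack d L w = vec (L * d) (\<lambda>r. w (int (r div d + 1)) $ (r mod d))"

text \<open>Window \<open>q\<close> begins at time \<open>q + 1\<close>. Stacking this signal gives
  the Hankel matrix of \<open>w\<close> times \<open>g\<close>.\<close>

definition window_comb :: "nat \<Rightarrow> nat \<Rightarrow> real vec \<Rightarrow> signal \<Rightarrow> signal" where
  "window_comb d m g w = sig_comb d {..<m} (\<lambda>q. g $ q) (\<lambda>q k. w (k + int q))"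

lemma sig_comb_carrier [simp]: "sig_comb d J c w k \<in> carrier_vec d"
  by (simp add: sig_comb_def)

lemma window_comb_carrier [simp]: "window_comb d m g w k \<in> carrier_vec d"
  by (simp add: window_comb_def)

lemma stack_carrier [simp]: "stack d L w \<in> carrier_vec (L * d)"
  by (simp add: stack_def)

lemma stack_nth:
  assumes "b < L" "i < d"
  shows "b * d + i < L * d" "stack d L w $ (b * d + i) = w (int b + 1) $ i"
proof -
  have "b * d + i < (b + 1) * d" using assms by simp
  also have "\<dots> \<le> L * d" using assms by (intro mult_right_mono) auto
  finally show *: "b * d + i < L * d" .
  show "stack d L w $ (b * d + i) = w (int b + 1) $ i"
    using assms * by (simp add: stack_def add.commute)
qed

lemma stack_eq_iff:
  assumes "\<And>k. k \<in> {1..int L} \<Longrightarrow> v k \<in> carrier_vec d" "\<And>k. k \<in> {1..int L} \<Longrightarrow> w k \<in> carrier_vec d"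
  shows "stack d L v = stack d L w \<longleftrightarrow> (\<forall>k\<in>{1..int L}. v k = w k)"
proof
  assume eq: "stack d L v = stack d L w"
  show "\<forall>k\<in>{1..int L}. v k = w k"
  proof
    fix k assume k: "k \<in> {1..int L}"
    define b where "b = nat (k - 1)"
    have b: "b < L" "k = int b + 1" using k by (auto simp: b_def)
    have "v k $ i = w k $ i" if "i < d" for i
      using stack_nth(2)[OF b(1) that] eq b(2) by metis
    with carrier_vecD[OF assms(1)[OF k]] carrier_vecD[OF assms(2)[OF k]] show "v k = w k"
      by (intro eq_vecI) simp_all
  qed
next
  assume eq: "\<forall>k\<in>{1..int L}. v k = w k"
  have "v (int (r div d + 1)) = w (int (r div d + 1))" if "r < L * d" for r
  proof -
    have "r div d < L" using that by (simp add: less_mult_imp_div_less)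
    then show ?thesis using eq by auto
  qed
  then show "stack d L v = stack d L w" by (intro eq_vecI) (auto simp: stack_def)
qed

lemma stack_zero: "stack d L (\<lambda>_. 0\<^sub>v d) = 0\<^sub>v (L * d)"
proof (intro eq_vecI)
  fix r assume "r < dim_vec (0\<^sub>v (L * d) :: real vec)"
  then have r: "r < L * d" by simp
  then have "d > 0" by (cases d) auto
  with r show "stack d L (\<lambda>_. 0\<^sub>v d) $ r = 0\<^sub>v (L * d) $ r" by (simp add: stack_def)
qed (simp add: stack_def)

lemma stack_eq_0_iff:
  assumes "\<And>k. k \<in> {1..int L} \<Longrightarrow> w k \<in> carrier_vec d"
  shows "stack d L w = 0\<^sub>v (L * d) \<longleftrightarrow> (\<forall>k\<in>{1..int L}. w k = 0\<^sub>v d)"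
  using stack_eq_iff[of L w d "\<lambda>_. 0\<^sub>v d"] assms by (simp add: stack_zero)

lemma stack_Suc:
  assumes "w (int L + 1) \<in> carrier_vec d"
  shows "stack d (Suc L) w = stack d L w @\<^sub>v w (int L + 1)"
proof (intro eq_vecI)
  fix r assume "r < dim_vec (stack d L w @\<^sub>v w (int L + 1))"
  then have r: "r < L * d + d" using assms by (simp add: stack_def)
  have "r div d = L \<and> r mod d = r - L * d" if "\<not> r < L * d"
  proof -
    define s where "s = r - L * d"
    have "r = L * d + s" "s < d" using that r by (auto simp: s_def)
    then show ?thesis by auto
  qed
  then show "stack d (Suc L) w $ r = (stack d L w @\<^sub>v w (int L + 1)) $ r"
    using r assms by (auto simp: stack_def add.commute)
qed (use assms in \<open>simp add: stack_def\<close>)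

lemma stack_scalar_prod:
  assumes "\<And>k. k \<in> {1..int L} \<Longrightarrow> v k \<in> carrier_vec d" "\<And>k. k \<in> {1..int L} \<Longrightarrow> w k \<in> carrier_vec d"
  shows "stack d L v \<bullet> stack d L w = (\<Sum>k=1..int L. v k \<bullet> w k)"
  using assms
proof (induction L)
  case (Suc L)
  have c: "v (int L + 1) \<in> carrier_vec d" "w (int L + 1) \<in> carrier_vec d" using Suc.prems by auto
  have "{1..int (Suc L)} = insert (int L + 1) {1..int L}" by auto
  then show ?case
    using Suc c scalar_prod_append[OF stack_carrier c(1) stack_carrier c(2)]
    by (simp add: stack_Suc add.commute)
qed (simp add: stack_def scalar_prod_def)

section \<open>Kronecker and block diagonal matrices acting on stacked signals\<close>

lemma sum_div_mod:
  fixes f :: "nat \<Rightarrow> nat \<Rightarrow> 'a::comm_monoid_add"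
  shows "(\<Sum>j<L * b. f (j div b) (j mod b)) = (\<Sum>k<L. \<Sum>i<b. f k i)"
proof -
  have "(\<Sum>j<L * b. f (j div b) (j mod b)) = (\<Sum>k<L. \<Sum>j=k*b..<k*b+b. f (j div b) (j mod b))"
    by (rule sum.nat_group[symmetric])
  also have "\<dots> = (\<Sum>k<L. \<Sum>i<b. f k i)"
    by (subst sum.atLeastLessThan_shift_0) (simp add: atLeast0LessThan)
  finally show ?thesis .
qed

text \<open>The Kronecker product with an identity repeats \<open>M\<close> along the diagonal, so
  only the block with \<open>j div b\<close> equal to \<open>r div a\<close> contributes to row
  \<open>r\<close>.\<close>

lemma kron_one_mult_stack:
  assumes M: "M \<in> carrier_mat a b" and w: "\<And>k. k \<in> {1..int L} \<Longrightarrow> w k \<in> carrier_vec b"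
  shows "kron_mat (1\<^sub>m L) M *\<^sub>v stack b L w = stack a L (\<lambda>k. M *\<^sub>v w k)"
proof (intro eq_vecI)
  fix r assume "r < dim_vec (stack a L (\<lambda>k. M *\<^sub>v w k))"
  then have r: "r < L * a" by (simp add: stack_def)
  then have ra: "r div a < L" "r mod a < a"
    by (auto simp: less_mult_imp_div_less intro!: mod_less_divisor) (cases a, auto)
  have "(kron_mat (1\<^sub>m L) M *\<^sub>v stack b L w) $ r =
     (\<Sum>j<L * b. (if r div a = j div b then M $$ (r mod a, j mod b) * w (int (j div b) + 1) $ (j mod b) else 0))"
    using r M ra(1)
    by (auto simp: kron_mat_def stack_def scalar_prod_def atLeast0LessThan less_mult_imp_div_less
        add.commute intro!: sum.cong)
  also have "\<dots> = (\<Sum>k<L. \<Sum>i<b. (if r div a = k then M $$ (r mod a, i) * w (int k + 1) $ i else 0))"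
    by (rule sum_div_mod)
  also have "\<dots> = (\<Sum>k<L. if r div a = k then (\<Sum>i<b. M $$ (r mod a, i) * w (int k + 1) $ i) else 0)"
    by (intro sum.cong refl) auto
  also have "\<dots> = (\<Sum>i<b. M $$ (r mod a, i) * w (int (r div a) + 1) $ i)"
    using ra by simp
  also have "\<dots> = stack a L (\<lambda>k. M *\<^sub>v w k) $ r"
    using r ra M w[of "int (r div a) + 1"]
    by (auto simp: stack_def scalar_prod_def atLeast0LessThan add.commute)
  finally show "(kron_mat (1\<^sub>m L) M *\<^sub>v stack b L w) $ r = stack a L (\<lambda>k. M *\<^sub>v w k) $ r" .
qed (use M in \<open>simp add: kron_mat_def stack_def\<close>)

text \<open>Explains the diagonal blocks in \<open>F_mat\<close>: applied to a signal value they
  form its Kronecker product with the scheduling.\<close>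

lemma kron_mat_col_mult:
  assumes "w \<in> carrier_vec d"
  shows "kron_mat (mat_of_cols (dim_vec v) [v]) (1\<^sub>m d) *\<^sub>v w = kron_vec v w"
proof (intro eq_vecI)
  fix r assume "r < dim_vec (kron_vec v w)"
  then have r: "r < dim_vec v * d" using assms by (simp add: kron_vec_def)
  then have rd: "r div d < dim_vec v" "r mod d < d"
    by (auto simp: less_mult_imp_div_less intro!: mod_less_divisor) (cases d, auto)
  have "(kron_mat (mat_of_cols (dim_vec v) [v]) (1\<^sub>m d) *\<^sub>v w) $ r
      = (\<Sum>j<d. if r mod d = j then v $ (r div d) * w $ j else 0)"
    using r rd assms
    by (auto simp: kron_mat_def scalar_prod_def atLeast0LessThan mat_of_cols_def if_distrib[of "\<lambda>x. x * _"] if_distrib[of "\<lambda>x. _ * x"]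
        intro!: sum.cong cong: if_cong)
  then show "(kron_mat (mat_of_cols (dim_vec v) [v]) (1\<^sub>m d) *\<^sub>v w) $ r = kron_vec v w $ r"
    using r rd assms by (simp add: kron_vec_def)
qed (use assms in \<open>simp add: kron_mat_def kron_vec_def\<close>)

lemma zero_mult_vec: "v \<in> carrier_vec n \<Longrightarrow> 0\<^sub>m a n *\<^sub>v v = (0\<^sub>v a :: real vec)"
  by (intro eq_vecI) auto

lemma diag_block_mat_mult_stack:
  assumes "\<And>k. k \<in> {1..L} \<Longrightarrow> f k \<in> carrier_mat a b" "\<And>k. k \<in> {1..int L} \<Longrightarrow> w k \<in> carrier_vec b"
  shows "diag_block_mat (map f [1..<L + 1]) \<in> carrier_mat (L * a) (L * b)"
    and "diag_block_mat (map f [1..<L + 1]) *\<^sub>v stack b L w = stack a L (\<lambda>k. f (nat k) *\<^sub>v w k)"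
proof -
  \<comment> \<open>Shape and product go through one induction, because splitting off the last block
    uses the shape of the preceding ones.\<close>
  have "diag_block_mat (map f [1..<L + 1]) \<in> carrier_mat (L * a) (L * b) \<and>
    diag_block_mat (map f [1..<L + 1]) *\<^sub>v stack b L w = stack a L (\<lambda>k. f (nat k) *\<^sub>v w k)"
    using assms
  proof (induction L)
    case 0
    then show ?case by (auto simp: stack_def intro!: eq_vecI)
  next
    case (Suc L)
    define D where "D = diag_block_mat (map f [1..<L + 1])"
    have D: "D \<in> carrier_mat (L * a) (L * b)"
      and m: "D *\<^sub>v stack b L w = stack a L (\<lambda>k. f (nat k) *\<^sub>v w k)" using Suc by (auto simp: D_def)
    have f: "f (Suc L) \<in> carrier_mat a b" and w: "w (int L + 1) \<in> carrier_vec b"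
      using Suc.prems by auto
    have n: "nat (int L + 1) = Suc L" by simp
    have e: "diag_block_mat (map f [1..<Suc L + 1])
        = four_block_mat D (0\<^sub>m (L * a) b) (0\<^sub>m a (L * b)) (f (Suc L))"
      using D f by (simp add: diag_block_mat_last D_def)
    have "diag_block_mat (map f [1..<Suc L + 1]) *\<^sub>v stack b (Suc L) w
        = (D *\<^sub>v stack b L w + 0\<^sub>m (L * a) b *\<^sub>v w (int L + 1))
          @\<^sub>v (0\<^sub>m a (L * b) *\<^sub>v stack b L w + f (Suc L) *\<^sub>v w (int L + 1))"
      unfolding e stack_Suc[of w, OF w] by (rule four_block_mat_mult_vec[OF D _ _ f]) (use w in auto)
    also have "\<dots> = stack a L (\<lambda>k. f (nat k) *\<^sub>v w k) @\<^sub>v (f (Suc L) *\<^sub>v w (int L + 1))"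
      using f w by (simp add: m zero_mult_vec[of _ "L * b"] zero_mult_vec[of _ b])
    also have "\<dots> = stack a (Suc L) (\<lambda>k. f (nat k) *\<^sub>v w k)"
      using f w by (simp add: stack_Suc n)
    finally show ?case
      using four_block_carrier_mat[OF D f] unfolding e by (simp add: add.commute)
  qed
  then show "diag_block_mat (map f [1..<L + 1]) \<in> carrier_mat (L * a) (L * b)"
    and "diag_block_mat (map f [1..<L + 1]) *\<^sub>v stack b L w = stack a L (\<lambda>k. f (nat k) *\<^sub>v w k)"
    by auto
qed

lemma sched_block_diag_mult_stack:
  assumes p: "\<And>k. k \<in> {1..int L} \<Longrightarrow> p k \<in> carrier_vec n"
    and w: "\<And>k. k \<in> {1..int L} \<Longrightarrow> w k \<in> carrier_vec d"
  shows "sched_block_diag d L p \<in> carrier_mat (L * (n * d)) (L * d)"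
    and "sched_block_diag d L p *\<^sub>v stack d L w = stack (n * d) L (\<lambda>k. kron_vec (p k) (w k))"
proof -
  let ?f = "\<lambda>i. kron_mat (mat_of_cols (dim_vec (p (int i))) [p (int i)]) (1\<^sub>m d)"
  have f: "?f k \<in> carrier_mat (n * d) d" if "k \<in> {1..L}" for k
    using p[of "int k"] that by (auto simp: kron_mat_def)
  show "sched_block_diag d L p \<in> carrier_mat (L * (n * d)) (L * d)"
    unfolding sched_block_diag_def by (rule diag_block_mat_mult_stack[OF f w])
  have "sched_block_diag d L p *\<^sub>v stack d L w = stack (n * d) L (\<lambda>k. ?f (nat k) *\<^sub>v w k)"
    unfolding sched_block_diag_def by (rule diag_block_mat_mult_stack[OF f w])
  also have "\<dots> = stack (n * d) L (\<lambda>k. kron_vec (p k) (w k))"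
  proof (subst stack_eq_iff)
    fix k assume k: "k \<in> {1..int L}"
    show "?f (nat k) *\<^sub>v w k \<in> carrier_vec (n * d)"
      using k by (intro mult_mat_vec_carrier[OF f w]) auto
    show "kron_vec (p k) (w k) \<in> carrier_vec (n * d)" using p[OF k] w[OF k] by (simp add: kron_vec_def)
  qed (use w in \<open>auto simp: kron_mat_col_mult\<close>)
  finally show "sched_block_diag d L p *\<^sub>v stack d L w = stack (n * d) L (\<lambda>k. kron_vec (p k) (w k))" .
qed

section \<open>Hankel matrices applied to a vector of weights\<close>

lemma hankel_carrier: "hankel d L N w \<in> carrier_mat (L * d) (N - L + 1)"
  by (simp add: hankel_def)

lemma hankel_mult_vec:
  assumes "g \<in> carrier_vec (N - L + 1)"
  shows "hankel d L N w *\<^sub>v g = stack d L (window_comb d (N - L + 1) g w)"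
proof (intro eq_vecI)
  fix r assume "r < dim_vec (stack d L (window_comb d (N - L + 1) g w))"
  then have r: "r < L * d" by (simp add: stack_def)
  then have rd: "r mod d < d" by (intro mod_less_divisor) (cases d, auto)
  show "(hankel d L N w *\<^sub>v g) $ r = stack d L (window_comb d (N - L + 1) g w) $ r"
    using r rd assms
    by (auto simp: hankel_def stack_def window_comb_def sig_comb_def scalar_prod_def atLeast0LessThan
        algebra_simps intro!: sum.cong)
qed (simp add: hankel_def stack_def)

lemma stacked_hankel_carrier:
  "stacked_hankel sys L N u y \<in> carrier_mat (L * n_u sys + L * n_y sys) (N - L + 1)"
  unfolding stacked_hankel_def by (intro carrier_append_rows hankel_carrier)

lemma stacked_hankel_mult_vec:
  assumes "g \<in> carrier_vec (N - L + 1)"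
  shows "stacked_hankel sys L N u y *\<^sub>v g =
    stack (n_u sys) L (window_comb (n_u sys) (N - L + 1) g u) @\<^sub>v
    stack (n_y sys) L (window_comb (n_y sys) (N - L + 1) g y)"
  unfolding stacked_hankel_def
  by (subst mat_mult_append[OF hankel_carrier hankel_carrier assms]) (simp only: hankel_mult_vec[OF assms])

lemma vec_diff_eq_0_iff:
  fixes v w :: "real vec"
  assumes "v \<in> carrier_vec n" "w \<in> carrier_vec n"
  shows "v - w = 0\<^sub>v n \<longleftrightarrow> v = w"
  using assms by (auto simp: vec_eq_iff)

text \<open>The first matrix combines the Kronecker products of the data; the second forms the
  Kronecker products of \<open>pb\<close> with the combined signal. Comparing two stacked vectors
  time by time and entry by entry turns the matrix equation into scalar identities.\<close>

lemma hankel_diff_mult_vec_eq_0_iff: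
  assumes g: "g \<in> carrier_vec (N - L + 1)" and p: "\<And>k. k \<in> {1..int L} \<Longrightarrow> pb k \<in> carrier_vec n"
    and pd: "\<And>k. k \<in> {1..int N} \<Longrightarrow> p k \<in> carrier_vec n" and w: "\<And>k. k \<in> {1..int N} \<Longrightarrow> w k \<in> carrier_vec d"
    and LN: "L < N"
  shows "(hankel (n * d) L N (\<lambda>k. kron_vec (p k) (w k)) - sched_block_diag d L pb * hankel d L N w) *\<^sub>v g
        = 0\<^sub>v (L * (n * d)) \<longleftrightarrow>
    (\<forall>k\<in>{1..int L}. \<forall>j<n. \<forall>i<d. (\<Sum>q<N - L + 1. g $ q * (p (k + int q) $ j * w (k + int q) $ i))
        = pb k $ j * window_comb d (N - L + 1) g w k $ i)" (is "?lhs = 0\<^sub>v _ \<longleftrightarrow> ?rhs")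
proof -
  let ?m = "N - L + 1"
  let ?kr = "window_comb (n * d) ?m g (\<lambda>k. kron_vec (p k) (w k))"
  let ?wc = "window_comb d ?m g w"
  note S = sched_block_diag_mult_stack[of L pb n ?wc d, OF p window_comb_carrier]
  have kc: "kron_vec (pb k) (?wc k) \<in> carrier_vec (n * d)" if "k \<in> {1..int L}" for k
    using p[OF that] by (simp add: kron_vec_def carrier_vecD[OF window_comb_carrier])
  have "?lhs = stack (n * d) L ?kr - stack (n * d) L (\<lambda>k. kron_vec (pb k) (?wc k))"
    by (simp only: minus_mult_distrib_mat_vec[OF hankel_carrier mult_carrier_mat[OF S(1) hankel_carrier] g]
        assoc_mult_mat_vec[OF S(1) hankel_carrier g] hankel_mult_vec[OF g] S(2))
  also have "\<dots> = 0\<^sub>v (L * (n * d)) \<longleftrightarrow> stack (n * d) L ?kr = stack (n * d) L (\<lambda>k. kron_vec (pb k) (?wc k))"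
    by (rule vec_diff_eq_0_iff) (rule stack_carrier)+
  also have "\<dots> \<longleftrightarrow> (\<forall>k\<in>{1..int L}. ?kr k = kron_vec (pb k) (?wc k))"
    by (rule stack_eq_iff[OF window_comb_carrier kc])
  also have "\<dots> \<longleftrightarrow> ?rhs"
  proof (intro ball_cong refl)
    fix k assume k: "k \<in> {1..int L}"
    \<comment> \<open>The last index reached is \<open>L + (N - L) = N\<close>, so all windows stay
      inside the data.\<close>
    have dk: "dim_vec (p (k + int q)) = n" "dim_vec (w (k + int q)) = d" if "q < ?m" for q
      using pd[of "k + int q"] w[of "k + int q"] that k LN by auto
    have dp: "dim_vec (pb k) = n" using p[OF k] by simp
    have l: "?kr k $ (j * d + i) = (\<Sum>q<?m. g $ q * (p (k + int q) $ j * w (k + int q) $ i))"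
      and r: "kron_vec (pb k) (?wc k) $ (j * d + i) = pb k $ j * ?wc k $ i"
      if ji: "j < n" "i < d" for j i
    proof -
      have "j * d + i < n * d" by (rule stack_nth(1)[OF ji])
      then show "?kr k $ (j * d + i) = (\<Sum>q<?m. g $ q * (p (k + int q) $ j * w (k + int q) $ i))"
        and "kron_vec (pb k) (?wc k) $ (j * d + i) = pb k $ j * ?wc k $ i"
        using ji dk dp
        by (auto simp: window_comb_def sig_comb_def kron_vec_def)
    qed
    show "?kr k = kron_vec (pb k) (?wc k) \<longleftrightarrow> (\<forall>j<n. \<forall>i<d.
      (\<Sum>q<?m. g $ q * (p (k + int q) $ j * w (k + int q) $ i)) = pb k $ j * ?wc k $ i)"
    proof
      assume eq: "?kr k = kron_vec (pb k) (?wc k)"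
      show "\<forall>j<n. \<forall>i<d.
        (\<Sum>q<?m. g $ q * (p (k + int q) $ j * w (k + int q) $ i)) = pb k $ j * ?wc k $ i"
      proof (intro allI impI)
        fix j i assume ji: "j < n" "i < d"
        show "(\<Sum>q<?m. g $ q * (p (k + int q) $ j * w (k + int q) $ i)) = pb k $ j * ?wc k $ i"
          unfolding l[OF ji, symmetric] r[OF ji, symmetric] eq ..
      qed
    next
      assume eq: "\<forall>j<n. \<forall>i<d.
        (\<Sum>q<?m. g $ q * (p (k + int q) $ j * w (k + int q) $ i)) = pb k $ j * ?wc k $ i"
      show "?kr k = kron_vec (pb k) (?wc k)"
      proof (intro eq_vecI)
        fix s assume "s < dim_vec (kron_vec (pb k) (?wc k))"
        then have s: "s < n * d" using kc[OF k] by simp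
        then have "s div d < n" "s mod d < d"
          by (auto simp: less_mult_imp_div_less intro!: mod_less_divisor) (cases d, auto)
        with l[of "s div d" "s mod d"] r[of "s div d" "s mod d"] eq
        show "?kr k $ s = kron_vec (pb k) (?wc k) $ s" by (simp only: div_mult_mod_eq)
      qed (use kc[OF k] in \<open>simp add: carrier_vecD[OF window_comb_carrier]\<close>)
    qed
  qed
  finally show ?thesis .
qed

section \<open>Accumulated supply as a quadratic form\<close>

lemma supply_rate_eq:
  assumes "Q \<in> carrier_mat nu nu" "S \<in> carrier_mat nu ny" "R \<in> carrier_mat ny ny"
    and "u \<in> carrier_vec nu" "y \<in> carrier_vec ny"
  shows "supply_rate Q S R u y = u \<bullet> (Q *\<^sub>v u + S *\<^sub>v y) + y \<bullet> (transpose_mat S *\<^sub>v u + R *\<^sub>v y)"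
  unfolding supply_rate_def supply_matrix_def
  using assms
  by (subst four_block_mat_mult_vec[of _ nu nu _ ny _ ny]) (auto intro!: scalar_prod_append)

lemma supply_rate_zero:
  assumes "Q \<in> carrier_mat nu nu" "S \<in> carrier_mat nu ny" "R \<in> carrier_mat ny ny"
  shows "supply_rate Q S R (0\<^sub>v nu) (0\<^sub>v ny) = 0"
  using assms by (simp add: supply_rate_eq[of _ nu _ ny])

text \<open>Each of the four blocks acts on every time separately, and a scalar product of stacked
  signals is the sum of the scalar products at the single times.\<close>

lemma Pi_L_quadratic:
  assumes Q: "Q \<in> carrier_mat nu nu" and S: "S \<in> carrier_mat nu ny" and R: "R \<in> carrier_mat ny ny"
    and u: "\<And>k. u k \<in> carrier_vec nu" and y: "\<And>k. y k \<in> carrier_vec ny"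
  shows "(stack nu L u @\<^sub>v stack ny L y) \<bullet> (Pi_L L Q S R *\<^sub>v (stack nu L u @\<^sub>v stack ny L y))
    = (\<Sum>k=1..int L. supply_rate Q S R (u k) (y k))"
proof -
  have c: "kron_mat (1\<^sub>m L) M \<in> carrier_mat (L * a) (L * b)" if "M \<in> carrier_mat a b" for M a b
    using that by (auto simp: kron_mat_def)
  have St: "transpose_mat S \<in> carrier_mat ny nu" using S by simp
  have add: "stack d L v + stack d L w = stack d L (\<lambda>k. v k + w k)"
    if "\<And>k. v k \<in> carrier_vec d" "\<And>k. w k \<in> carrier_vec d" for d v w
  proof (intro eq_vecI)
    fix r assume "r < dim_vec (stack d L (\<lambda>k. v k + w k))"
    then have r: "r < L * d" by (simp add: stack_def)
    then have "r mod d < d" by (intro mod_less_divisor) (cases d, auto)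
    with r carrier_vecD[OF that(1)] carrier_vecD[OF that(2)]
    show "(stack d L v + stack d L w) $ r = stack d L (\<lambda>k. v k + w k) $ r" by (simp add: stack_def)
  qed (simp add: stack_def)
  have "Pi_L L Q S R *\<^sub>v (stack nu L u @\<^sub>v stack ny L y)
      = stack nu L (\<lambda>k. Q *\<^sub>v u k + S *\<^sub>v y k)
        @\<^sub>v stack ny L (\<lambda>k. transpose_mat S *\<^sub>v u k + R *\<^sub>v y k)"
    unfolding Pi_L_def
    by (subst four_block_mat_mult_vec[OF c[OF Q] c[OF S] c[OF St] c[OF R] stack_carrier stack_carrier])
      (simp only: kron_one_mult_stack[OF Q u] kron_one_mult_stack[OF S y] kron_one_mult_stack[OF St u]
        kron_one_mult_stack[OF R y] add mult_mat_vec_carrier[OF Q u] mult_mat_vec_carrier[OF S y]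
        mult_mat_vec_carrier[OF St u] mult_mat_vec_carrier[OF R y])
  then have "(stack nu L u @\<^sub>v stack ny L y) \<bullet> (Pi_L L Q S R *\<^sub>v (stack nu L u @\<^sub>v stack ny L y))
    = stack nu L u \<bullet> stack nu L (\<lambda>k. Q *\<^sub>v u k + S *\<^sub>v y k)
      + stack ny L y \<bullet> stack ny L (\<lambda>k. transpose_mat S *\<^sub>v u k + R *\<^sub>v y k)"
    by (simp only: scalar_prod_append[OF stack_carrier stack_carrier stack_carrier stack_carrier])
  also have "\<dots> = (\<Sum>k=1..int L. u k \<bullet> (Q *\<^sub>v u k + S *\<^sub>v y k))
      + (\<Sum>k=1..int L. y k \<bullet> (transpose_mat S *\<^sub>v u k + R *\<^sub>v y k))"
    using u y mult_mat_vec_carrier[OF Q u] mult_mat_vec_carrier[OF S y]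
        mult_mat_vec_carrier[OF St u] mult_mat_vec_carrier[OF R y]
    by (simp only: stack_scalar_prod add_carrier_vec)
  finally show ?thesis
    by (simp only: supply_rate_eq[OF Q S R u y] sum.distrib)
qed

text \<open>Moving the transposed Hankel matrix to the other side of the scalar product leaves the
  form of \<open>Pi_L\<close> at the stacked combined signals.\<close>

lemma Pi_H_quadratic:
  assumes Q: "Q \<in> carrier_mat (n_u sys) (n_u sys)" and S: "S \<in> carrier_mat (n_u sys) (n_y sys)"
    and R: "R \<in> carrier_mat (n_y sys) (n_y sys)" and g: "g \<in> carrier_vec (N - L + 1)"
  shows "g \<bullet> (Pi_H sys L N u y Q S R *\<^sub>v g) =
    (\<Sum>k=1..int L. supply_rate Q S R (window_comb (n_u sys) (N - L + 1) g u k)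
       (window_comb (n_y sys) (N - L + 1) g y k))"
proof -
  let ?d = "L * n_u sys + L * n_y sys" and ?m = "N - L + 1" and ?H = "stacked_hankel sys L N u y"
  have H: "?H \<in> carrier_mat ?d ?m" by (rule stacked_hankel_carrier)
  then have Ht: "transpose_mat ?H \<in> carrier_mat ?m ?d" by simp
  have P: "Pi_L L Q S R \<in> carrier_mat ?d ?d"
    using Q R unfolding Pi_L_def by (intro four_block_carrier_mat) (auto simp: kron_mat_def)
  have x: "Pi_L L Q S R *\<^sub>v (?H *\<^sub>v g) \<in> carrier_vec ?d"
    using P H g by (intro mult_mat_vec_carrier)
  have "Pi_H sys L N u y Q S R *\<^sub>v g = transpose_mat ?H *\<^sub>v (Pi_L L Q S R *\<^sub>v (?H *\<^sub>v g))"
    unfolding Pi_H_def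
    by (simp only: assoc_mult_mat_vec[OF mult_carrier_mat[OF Ht P] H g]
        assoc_mult_mat_vec[OF Ht P mult_mat_vec_carrier[OF H g]])
  then have "g \<bullet> (Pi_H sys L N u y Q S R *\<^sub>v g)
      = (transpose_mat ?H *\<^sub>v (Pi_L L Q S R *\<^sub>v (?H *\<^sub>v g))) \<bullet> g"
    by (simp only: comm_scalar_prod[OF g mult_mat_vec_carrier[OF Ht x]])
  also have "\<dots> = (Pi_L L Q S R *\<^sub>v (?H *\<^sub>v g)) \<bullet> (?H *\<^sub>v g)"
    by (rule transpose_vec_mult_scalar[OF H g x])
  also have "\<dots> = (?H *\<^sub>v g) \<bullet> (Pi_L L Q S R *\<^sub>v (?H *\<^sub>v g))"
    by (rule comm_scalar_prod[OF x mult_mat_vec_carrier[OF H g]])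
  finally show ?thesis
    unfolding stacked_hankel_mult_vec[OF g]
    by (simp only: Pi_L_quadratic[OF Q S R window_comb_carrier window_comb_carrier])
qed

lemma zero_vec_append: "0\<^sub>v a @\<^sub>v 0\<^sub>v b = 0\<^sub>v (a + b)"
  by (intro eq_vecI) auto

lemma append_vec_eq_0_iff:
  assumes "v \<in> carrier_vec a" "w \<in> carrier_vec b"
  shows "v @\<^sub>v w = 0\<^sub>v (a + b) \<longleftrightarrow> v = 0\<^sub>v a \<and> w = 0\<^sub>v b"
  using append_vec_eq[OF assms(1), of "0\<^sub>v a" w "0\<^sub>v b"] by (simp add: zero_vec_append)

section \<open>The data condition in terms of combined windows\<close>

lemma head_select_mult_stack:
  assumes "\<tau> \<le> L"
  shows "head_select d \<tau> L \<in> carrier_mat (\<tau> * d) (L * d)"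
    and "head_select d \<tau> L *\<^sub>v stack d L w = stack d \<tau> w"
proof -
  show c: "head_select d \<tau> L \<in> carrier_mat (\<tau> * d) (L * d)"
    by (simp add: head_select_def mult.commute)
  show "head_select d \<tau> L *\<^sub>v stack d L w = stack d \<tau> w"
  proof (intro eq_vecI)
    fix r assume "r < dim_vec (stack d \<tau> w)"
    then have r: "r < \<tau> * d" by (simp add: stack_def)
    then have r': "r < L * d" using assms by (meson less_le_trans mult_le_mono1)
    have "(head_select d \<tau> L *\<^sub>v stack d L w) $ r = (\<Sum>j<L * d. if r = j then stack d L w $ j else 0)"
      using r r' by (auto simp: head_select_def scalar_prod_def stack_def atLeast0LessThan mult.commute
          if_distrib[of "\<lambda>x. x * _"] intro!: sum.cong cong: if_cong)
    then show "(head_select d \<tau> L *\<^sub>v stack d L w) $ r = stack d \<tau> w $ r"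
      using r r' by (simp add: stack_def)
  qed (simp add: head_select_def stack_def mult.commute)
qed

lemma V_mat_mult_stack:
  assumes "\<tau> \<le> L"
  shows "V_mat sys \<tau> L \<in> carrier_mat (\<tau> * n_u sys + \<tau> * n_y sys) (L * n_u sys + L * n_y sys)"
    and "V_mat sys \<tau> L *\<^sub>v (stack (n_u sys) L u @\<^sub>v stack (n_y sys) L y)
      = stack (n_u sys) \<tau> u @\<^sub>v stack (n_y sys) \<tau> y"
proof -
  note h = head_select_mult_stack[OF assms]
  have V: "V_mat sys \<tau> L = four_block_mat (head_select (n_u sys) \<tau> L)
      (0\<^sub>m (\<tau> * n_u sys) (L * n_y sys)) (0\<^sub>m (\<tau> * n_y sys) (L * n_u sys)) (head_select (n_y sys) \<tau> L)"
    unfolding V_mat_def diag_block_mat.simps(2)[of _ "[_]"] diag_block_mat_singleton Let_def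
    using h(1)[of "n_u sys"] h(1)[of "n_y sys"] by simp
  show "V_mat sys \<tau> L \<in> carrier_mat (\<tau> * n_u sys + \<tau> * n_y sys) (L * n_u sys + L * n_y sys)"
    unfolding V by (rule four_block_carrier_mat[OF h(1) h(1)])
  show "V_mat sys \<tau> L *\<^sub>v (stack (n_u sys) L u @\<^sub>v stack (n_y sys) L y)
      = stack (n_u sys) \<tau> u @\<^sub>v stack (n_y sys) \<tau> y"
    unfolding V
    by (subst four_block_mat_mult_vec[OF h(1) _ _ h(1)])
      (auto simp: h(2) zero_mult_vec[of _ "L * n_u sys"] zero_mult_vec[of _ "L * n_y sys"])
qed

text \<open>Only dimensions are fixed here and no dynamics, which is enough to unfold the matrices
  built from the data.\<close>

locale hankel_data =
  fixes sys :: lpv_io and L N :: nat and u p y pb :: signal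
  assumes LN: "L < N"
    and pb: "\<And>k. k \<in> {1..int L} \<Longrightarrow> pb k \<in> carrier_vec (n_p sys)"
    and p: "\<And>k. k \<in> {1..int N} \<Longrightarrow> p k \<in> carrier_vec (n_p sys)"
    and u: "\<And>k. k \<in> {1..int N} \<Longrightarrow> u k \<in> carrier_vec (n_u sys)"
    and y: "\<And>k. k \<in> {1..int N} \<Longrightarrow> y k \<in> carrier_vec (n_y sys)"
begin

lemma hankel_diff_carrier:
  "hankel (n_p sys * d) L N w' - sched_block_diag d L pb * hankel d L N w
    \<in> carrier_mat (L * (n_p sys * d)) (N - L + 1)"
proof -
  have "sched_block_diag d L pb \<in> carrier_mat (L * (n_p sys * d)) (L * d)"
    by (rule sched_block_diag_mult_stack(1)[of L pb "n_p sys" "\<lambda>_. 0\<^sub>v d", OF pb]) auto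
  then show ?thesis using hankel_carrier by (intro minus_carrier_mat mult_carrier_mat)
qed

lemma sched_rows_carrier:
  "sched_rows sys L N u p y pb
    \<in> carrier_mat (L * (n_p sys * n_u sys) + L * (n_p sys * n_y sys)) (N - L + 1)"
  unfolding sched_rows_def by (intro carrier_append_rows hankel_diff_carrier)

lemma sched_rows_kernel_iff:
  assumes g: "g \<in> carrier_vec (N - L + 1)"
  shows "g \<in> mat_kernel (sched_rows sys L N u p y pb) \<longleftrightarrow>
    (\<forall>k\<in>{1..int L}. \<forall>j<n_p sys. \<forall>i<n_u sys.
      (\<Sum>q<N - L + 1. g $ q * (p (k + int q) $ j * u (k + int q) $ i))
        = pb k $ j * window_comb (n_u sys) (N - L + 1) g u k $ i) \<and>
    (\<forall>k\<in>{1..int L}. \<forall>j<n_p sys. \<forall>i<n_y sys.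
      (\<Sum>q<N - L + 1. g $ q * (p (k + int q) $ j * y (k + int q) $ i))
        = pb k $ j * window_comb (n_y sys) (N - L + 1) g y k $ i)"
  unfolding mat_kernel[OF sched_rows_carrier] mem_Collect_eq
  unfolding sched_rows_def mat_mult_append[OF hankel_diff_carrier hankel_diff_carrier g]
    append_vec_eq_0_iff[OF mult_mat_vec_carrier[OF hankel_diff_carrier g]
      mult_mat_vec_carrier[OF hankel_diff_carrier g]]
  by (simp only: g simp_thms
      hankel_diff_mult_vec_eq_0_iff[of g N L pb "n_p sys" p u, OF g pb p u LN]
      hankel_diff_mult_vec_eq_0_iff[of g N L pb "n_p sys" p y, OF g pb p y LN])

text \<open>Eliminates the matrices: the top block row of \<open>F_mat\<close> says that the
  combined signals vanish up to time \<open>\<tau>\<close>, the remaining rows are the kernel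
  condition, and the quadratic form is the accumulated supply.\<close>

lemma data_condition_iff:
  assumes \<tau>: "\<tau> < L"
    and Q: "Q \<in> carrier_mat (n_u sys) (n_u sys)" and S: "S \<in> carrier_mat (n_u sys) (n_y sys)"
    and R: "R \<in> carrier_mat (n_y sys) (n_y sys)"
  shows "data_condition sys \<tau> L N u p y Q S R pb \<longleftrightarrow>
    (\<forall>g\<in>mat_kernel (sched_rows sys L N u p y pb).
       (\<forall>k\<in>{1..int \<tau>}. window_comb (n_u sys) (N - L + 1) g u k = 0\<^sub>v (n_u sys)
          \<and> window_comb (n_y sys) (N - L + 1) g y k = 0\<^sub>v (n_y sys)) \<longrightarrow>
       (\<Sum>k=1..int L. supply_rate Q S R (window_comb (n_u sys) (N - L + 1) g u k)
          (window_comb (n_y sys) (N - L + 1) g y k)) \<ge> 0)"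
proof -
  let ?m = "N - L + 1" and ?H = "stacked_hankel sys L N u y" and ?F = "F_mat sys \<tau> L N u p y pb"
  let ?r = "L * (n_p sys * n_u sys) + L * (n_p sys * n_y sys)"
  let ?v = "\<tau> * n_u sys + \<tau> * n_y sys"
  have V: "V_mat sys \<tau> L \<in> carrier_mat ?v (L * n_u sys + L * n_y sys)"
    by (rule V_mat_mult_stack(1)) (use \<tau> in simp)
  note VH = mult_carrier_mat[OF V stacked_hankel_carrier]
  have F: "?F \<in> carrier_mat (?v + ?r) ?m"
    unfolding F_mat_def by (rule carrier_append_rows[OF VH sched_rows_carrier])
  have "?F *\<^sub>v g = 0\<^sub>v (dim_row ?F) \<longleftrightarrow> g \<in> mat_kernel (sched_rows sys L N u p y pb) \<and>
      (\<forall>k\<in>{1..int \<tau>}. window_comb (n_u sys) ?m g u k = 0\<^sub>v (n_u sys)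
          \<and> window_comb (n_y sys) ?m g y k = 0\<^sub>v (n_y sys))"
    if g: "g \<in> carrier_vec ?m" for g
  proof -
    have "?F *\<^sub>v g = (stack (n_u sys) \<tau> (window_comb (n_u sys) ?m g u)
        @\<^sub>v stack (n_y sys) \<tau> (window_comb (n_y sys) ?m g y)) @\<^sub>v (sched_rows sys L N u p y pb *\<^sub>v g)"
      unfolding F_mat_def mat_mult_append[OF VH sched_rows_carrier g]
        assoc_mult_mat_vec[OF V stacked_hankel_carrier g] stacked_hankel_mult_vec[OF g]
        V_mat_mult_stack(2)[OF less_imp_le[OF \<tau>]] ..
    then show ?thesis
      using append_vec_eq_0_iff[OF append_carrier_vec[OF stack_carrier stack_carrier]
          mult_mat_vec_carrier[OF sched_rows_carrier g]]
      by (auto simp only: carrier_matD(1)[OF F] append_vec_eq_0_iff[OF stack_carrier stack_carrier]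
          stack_eq_0_iff[OF window_comb_carrier] mat_kernel[OF sched_rows_carrier] g mem_Collect_eq)
  qed
  moreover have "g \<in> carrier_vec ?m" if "g \<in> mat_kernel (sched_rows sys L N u p y pb)" for g
    using mat_kernel_carrier[OF sched_rows_carrier] that by blast
  ultimately show ?thesis
    unfolding data_condition_def by (metis (no_types, lifting) Pi_H_quadratic[OF Q S R])
qed

end

section \<open>Solutions of the difference equation\<close>

text \<open>With affine coefficients the difference equation is linear in the products of scheduling and signal
  entries, and these products are what the kernel condition controls.\<close>

definition moment :: "signal \<Rightarrow> signal \<Rightarrow> int \<Rightarrow> nat \<Rightarrow> nat \<Rightarrow> real" where
  "moment P w t j c = sched_entry (P t) j * w t $ c"

text \<open>The difference equation solved for the current output, with scheduling and signals
  entering through their moments only. The output sum starts at \<open>i = 1\<close>, so no current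
  output appears.\<close>

definition drive :: "lpv_io \<Rightarrow> (int \<Rightarrow> nat \<Rightarrow> nat \<Rightarrow> real) \<Rightarrow> (int \<Rightarrow> nat \<Rightarrow> nat \<Rightarrow> real) \<Rightarrow> int \<Rightarrow> nat \<Rightarrow> real" where
  "drive sys mu my k r =
     (\<Sum>(i, c, j)\<in>{0..n_b sys} \<times> {..<n_u sys} \<times> {0..n_p sys}. b_coef sys i j $$ (r, c) * mu (k - int i) j c)
     - (\<Sum>(i, c, j)\<in>{1..n_a sys} \<times> {..<n_y sys} \<times> {0..n_p sys}. a_coef sys i j $$ (r, c) * my (k - int i) j c)"

text \<open>Carries all causality arguments: the ranges say how far back the equation looks, and
  that outputs count strictly before \<open>k\<close>.\<close>

lemma drive_cong:
  assumes "\<And>t j c. k - int (n_b sys) \<le> t \<Longrightarrow> t \<le> k \<Longrightarrow> j \<le> n_p sys \<Longrightarrow> c < n_u sys \<Longrightarrow> mu t j c = mu' t j c"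
    and "\<And>t j c. k - int (n_a sys) \<le> t \<Longrightarrow> t < k \<Longrightarrow> j \<le> n_p sys \<Longrightarrow> c < n_y sys \<Longrightarrow> my t j c = my' t j c"
  shows "drive sys mu my k r = drive sys mu' my' k r"
  unfolding drive_def
  by (intro arg_cong2[of _ _ _ _ "(-)"] sum.cong) (auto simp: assms)

text \<open>Linearity is in the moments, not in signals under one scheduling. Windows recorded under
  different schedulings can therefore be combined.\<close>

lemma drive_sum:
  "drive sys (\<lambda>t j c. \<Sum>q\<in>J. g q * mu q t j c) (\<lambda>t j c. \<Sum>q\<in>J. g q * my q t j c) k r
    = (\<Sum>q\<in>J. g q * drive sys (mu q) (my q) k r)"
proof -
  have swap: "(\<Sum>x\<in>X. A x * (\<Sum>q\<in>J. g q * m q x)) = (\<Sum>q\<in>J. g q * (\<Sum>x\<in>X. A x * m q x))"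
    for X :: "(nat \<times> nat \<times> nat) set" and A :: "nat \<times> nat \<times> nat \<Rightarrow> real" and m
    unfolding sum_distrib_left by (subst sum.swap) (intro sum.cong refl mult.left_commute)
  show ?thesis
    unfolding drive_def right_diff_distrib sum_subtractf case_prod_unfold
    by (simp only: swap[where m = "\<lambda>q x. mu q (k - int (fst x)) (snd (snd x)) (fst (snd x))"]
        swap[where m = "\<lambda>q x. my q (k - int (fst x)) (snd (snd x)) (fst (snd x))"])
qed

lemma drive_shift:
  "drive sys mu my (k + s) r = drive sys (\<lambda>t. mu (t + s)) (\<lambda>t. my (t + s)) k r"
  unfolding drive_def by (simp add: algebra_simps)

text \<open>Past and future form one signal on all integers, so a shifted window needs no case
  distinction between initial condition and trajectory.\<close>

definition lpv_eq :: "lpv_io \<Rightarrow> signal \<Rightarrow> signal \<Rightarrow> signal \<Rightarrow> int \<Rightarrow> bool" where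
  "lpv_eq sys P U Y k \<longleftrightarrow> (\<forall>r<n_y sys. Y k $ r = drive sys (moment P U) (moment P Y) k r)"

text \<open>Course-of-values recursion beyond \<open>T\<close>. Values from \<open>k\<close> on are
  masked by an arbitrary default, which makes every recursive call refer to an earlier time.\<close>

function rec_signal :: "int \<Rightarrow> (signal \<Rightarrow> signal) \<Rightarrow> signal \<Rightarrow> signal" where
  "rec_signal T F w k = (if k \<le> T then w k
     else F (\<lambda>j. if j < k then rec_signal T F w j else 0\<^sub>v 0) k)"
  by auto
termination by (relation "measure (\<lambda>(T, F, w, k). nat (k - T))") auto

declare rec_signal.simps [simp del]

text \<open>The equation is explicit in the current output, so any past up to \<open>T\<close> can
  be continued by computing the outputs one after another.\<close>

lemma lpv_eq_extend:
  obtains Y where "\<And>k. k \<le> T \<Longrightarrow> Y k = Y\<^sub>0 k"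
    and "\<And>k. k > T \<Longrightarrow> Y k \<in> carrier_vec (n_y sys)"
    and "\<And>k. k > T \<Longrightarrow> lpv_eq sys P U Y k"
proof -
  define F where "F = (\<lambda>Y k. vec (n_y sys) (\<lambda>r. drive sys (moment P U) (moment P Y) k r))"
  define Y where "Y = rec_signal T F Y\<^sub>0"
  \<comment> \<open>The mask is invisible: \<open>drive\<close> at \<open>k\<close> reads outputs
    before \<open>k\<close> only.\<close>
  have Y: "Y k = F Y k" if "k > T" for k
  proof -
    have "Y k = F (\<lambda>j. if j < k then Y j else 0\<^sub>v 0) k"
      using that unfolding Y_def by (subst rec_signal.simps) simp
    also have "\<dots> = F Y k"
      unfolding F_def by (intro eq_vecI) (auto intro!: drive_cong simp: moment_def)
    finally show ?thesis .
  qed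
  show ?thesis
  proof (rule that[of Y])
    show "Y k = Y\<^sub>0 k" if "k \<le> T" for k using that unfolding Y_def by (subst rec_signal.simps) simp
    show "Y k \<in> carrier_vec (n_y sys)" if "k > T" for k by (subst Y[OF that]) (simp add: F_def)
    show "lpv_eq sys P U Y k" if "k > T" for k
      unfolding lpv_eq_def by (subst (1) Y[OF that]) (simp add: F_def)
  qed
qed

text \<open>A trajectory glued to its initial condition. Each signal is constrained in the past only
  as deep as the initial condition records it, and \<open>restrict\<close> recovers the admissible
  scheduling on positive times.\<close>

definition lpv_sol :: "lpv_io \<Rightarrow> signal \<Rightarrow> signal \<Rightarrow> signal \<Rightarrow> bool" where
  "lpv_sol sys P U Y \<longleftrightarrow> (\<forall>t\<ge>1 - int (n_b sys). U t \<in> carrier_vec (n_u sys))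
     \<and> (\<forall>t\<ge>1 - int (n_a sys). Y t \<in> carrier_vec (n_y sys))
     \<and> (\<forall>t\<in>{1 - int (n_r sys)..0}. P t \<in> sched_set sys) \<and> restrict P {1..} \<in> adm_sched sys
     \<and> (\<forall>k\<ge>1. lpv_eq sys P U Y k)"

lemma solves_iff:
  assumes y: "\<And>t. t \<ge> 1 - int (n_a sys) \<Longrightarrow> prepend y\<^sub>0 y t \<in> carrier_vec (n_y sys)"
    and u: "\<And>t. t \<ge> 1 - int (n_b sys) \<Longrightarrow> prepend u\<^sub>0 u t \<in> carrier_vec (n_u sys)"
  shows "solves sys (y\<^sub>0, p\<^sub>0, u\<^sub>0) (u, p, y)
    \<longleftrightarrow> (\<forall>k\<ge>1. lpv_eq sys (prepend p\<^sub>0 p) (prepend u\<^sub>0 u) (prepend y\<^sub>0 y) k)"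
proof -
  let ?P = "prepend p\<^sub>0 p" and ?U = "prepend u\<^sub>0 u" and ?Y = "prepend y\<^sub>0 y"
  let ?A = "\<lambda>k. finsum_vec TYPE(real) (n_y sys)
    (\<lambda>i. a_fun sys i (?P (k - int i)) *\<^sub>v ?Y (k - int i)) {1..n_a sys}"
  let ?B = "\<lambda>k. finsum_vec TYPE(real) (n_y sys)
    (\<lambda>i. b_fun sys i (?P (k - int i)) *\<^sub>v ?U (k - int i)) {0..n_b sys}"
  have aff: "(affine_mat nr nc np M q *\<^sub>v v) $ r = (\<Sum>(c, j)\<in>{..<nc} \<times> {0..np}. M j $$ (r, c) * (sched_entry q j * v $ c))"
    if "v \<in> carrier_vec nc" "r < nr" for nr nc np M q v r
  proof -
    have "(affine_mat nr nc np M q *\<^sub>v v) $ r = (\<Sum>c<nc. (\<Sum>j=0..np. sched_entry q j * M j $$ (r, c)) * v $ c)"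
      using that by (auto simp: affine_mat_def scalar_prod_def atLeast0LessThan)
    also have "\<dots> = (\<Sum>c<nc. \<Sum>j=0..np. M j $$ (r, c) * (sched_entry q j * v $ c))"
      unfolding sum_distrib_right by (intro sum.cong refl) (simp add: mult_ac)
    finally show ?thesis by (simp add: sum.cartesian_product)
  qed
  have cA: "(\<lambda>i. a_fun sys i (?P (k - int i)) *\<^sub>v ?Y (k - int i)) \<in> X \<rightarrow> carrier_vec (n_y sys)" for k X
    by (intro Pi_I carrier_vecI) (simp add: a_fun_def affine_mat_def)
  have cB: "(\<lambda>i. b_fun sys i (?P (k - int i)) *\<^sub>v ?U (k - int i)) \<in> X \<rightarrow> carrier_vec (n_y sys)" for k X
    by (intro Pi_I carrier_vecI) (simp add: b_fun_def affine_mat_def)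
  have "y k + ?A k = ?B k \<longleftrightarrow> lpv_eq sys ?P ?U ?Y k" if k: "k \<ge> 1" for k
  proof -
    have yk: "y k \<in> carrier_vec (n_y sys)" "?Y k = y k" using y[of k] k by (auto simp: prepend_def)
    have "y k + ?A k = ?B k \<longleftrightarrow> (\<forall>r<n_y sys. y k $ r + ?A k $ r = ?B k $ r)"
      using carrier_vecD[OF yk(1)] carrier_vecD[OF finsum_vec_closed[OF cA]]
        carrier_vecD[OF finsum_vec_closed[OF cB]] by (simp add: vec_eq_iff)
    also have "\<dots> \<longleftrightarrow> lpv_eq sys ?P ?U ?Y k"
      unfolding lpv_eq_def
    proof (intro all_cong)
      fix r assume r: "r < n_y sys"
      have "?A k $ r = (\<Sum>i=1..n_a sys. \<Sum>(c, j)\<in>{..<n_y sys} \<times> {0..n_p sys}.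
          a_coef sys i j $$ (r, c) * moment ?P ?Y (k - int i) j c)"
        unfolding index_finsum_vec[OF finite_atLeastAtMost r cA]
        unfolding a_fun_def moment_def
        using k r by (intro sum.cong refl aff y) auto
      moreover have "?B k $ r = (\<Sum>i=0..n_b sys. \<Sum>(c, j)\<in>{..<n_u sys} \<times> {0..n_p sys}.
          b_coef sys i j $$ (r, c) * moment ?P ?U (k - int i) j c)"
        unfolding index_finsum_vec[OF finite_atLeastAtMost r cB]
        unfolding b_fun_def moment_def
        using k r by (intro sum.cong refl aff u) auto
      ultimately show "y k $ r + ?A k $ r = ?B k $ r \<longleftrightarrow>
          ?Y k $ r = drive sys (moment ?P ?U) (moment ?P ?Y) k r"
        unfolding drive_def yk by (auto simp: sum.cartesian_product case_prod_unfold)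
    qed
    finally show ?thesis .
  qed
  then show ?thesis by simp
qed

lemma lpv_eq_cong:
  assumes "\<And>t. t \<ge> k - int (n_r sys) \<Longrightarrow> P t = P' t"
    and "\<And>t. t \<ge> k - int (n_b sys) \<Longrightarrow> U t = U' t"
    and "\<And>t. t \<ge> k - int (n_a sys) \<Longrightarrow> Y t = Y' t"
  shows "lpv_eq sys P U Y k \<longleftrightarrow> lpv_eq sys P' U' Y' k"
proof -
  have "drive sys (moment P U) (moment P Y) k r = drive sys (moment P' U') (moment P' Y') k r" for r
    using assms by (intro drive_cong) (auto simp: moment_def n_r_def)
  then show ?thesis using assms(3)[of k] by (simp add: lpv_eq_def)
qed

lemma lpv_sol_of_solves:
  assumes w: "(u, p, y) \<in> trajectories sys" "(y\<^sub>0, p\<^sub>0, u\<^sub>0) \<in> initial_conditions sys"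
    "solves sys (y\<^sub>0, p\<^sub>0, u\<^sub>0) (u, p, y)" and adm: "adm_sched sys \<subseteq> ({1..} \<rightarrow>\<^sub>E sched_set sys)"
  shows "lpv_sol sys (prepend p\<^sub>0 p) (prepend u\<^sub>0 u) (prepend y\<^sub>0 y)"
proof -
  have u: "u \<in> {1..} \<rightarrow>\<^sub>E carrier_vec (n_u sys)" and p: "p \<in> adm_sched sys"
    and y: "y \<in> {1..} \<rightarrow>\<^sub>E carrier_vec (n_y sys)" using w(1) by (auto simp: trajectories_def)
  have p': "p \<in> {1..} \<rightarrow>\<^sub>E sched_set sys" using p adm by auto
  have restr: "restrict (prepend p\<^sub>0 p) {1..} = p"
    using p' by (auto simp: prepend_def restrict_def fun_eq_iff PiE_def extensional_def)
  have cu: "prepend u\<^sub>0 u t \<in> carrier_vec (n_u sys)" if "t \<ge> 1 - int (n_b sys)" for t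
    using that u w(2) by (auto simp: prepend_def initial_conditions_def PiE_def Pi_def)
  have cy: "prepend y\<^sub>0 y t \<in> carrier_vec (n_y sys)" if "t \<ge> 1 - int (n_a sys)" for t
    using that y w(2) by (auto simp: prepend_def initial_conditions_def PiE_def Pi_def)
  have cp: "prepend p\<^sub>0 p t \<in> sched_set sys" if "t \<in> {1 - int (n_r sys)..0}" for t
    using that w(2) by (auto simp: prepend_def initial_conditions_def PiE_def Pi_def)
  show "lpv_sol sys (prepend p\<^sub>0 p) (prepend u\<^sub>0 u) (prepend y\<^sub>0 y)"
    unfolding lpv_sol_def restr
    using cu cy cp p w(3) solves_iff[of sys y\<^sub>0 y u\<^sub>0 u p\<^sub>0 p, OF cy cu] by blast
qed

lemma solves_of_lpv_sol:
  assumes sol: "lpv_sol sys P U Y"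
  defines "y\<^sub>0 \<equiv> restrict Y {1 - int (n_a sys)..0}" and "p\<^sub>0 \<equiv> restrict P {1 - int (n_r sys)..0}"
    and "u\<^sub>0 \<equiv> restrict U {1 - int (n_b sys)..0}"
    and "y \<equiv> restrict Y {1..}" and "p \<equiv> restrict P {1..}" and "u \<equiv> restrict U {1..}"
  shows "(u, p, y) \<in> trajectories sys" "(y\<^sub>0, p\<^sub>0, u\<^sub>0) \<in> initial_conditions sys"
    "solves sys (y\<^sub>0, p\<^sub>0, u\<^sub>0) (u, p, y)"
proof -
  note defs = y\<^sub>0_def p\<^sub>0_def u\<^sub>0_def y_def p_def u_def
  show "(u, p, y) \<in> trajectories sys" "(y\<^sub>0, p\<^sub>0, u\<^sub>0) \<in> initial_conditions sys"
    using sol by (auto simp: defs lpv_sol_def trajectories_def initial_conditions_def)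
  \<comment> \<open>Each past signal is kept as deep as the equation at times
    \<open>k \<ge> 1\<close> can reach, so that equation cannot distinguish the cut signals from the
    original ones.\<close>
  have eq: "prepend y\<^sub>0 y t = Y t" if "t \<ge> 1 - int (n_a sys)" for t
    using that by (auto simp: prepend_def defs)
  have eq': "prepend u\<^sub>0 u t = U t" if "t \<ge> 1 - int (n_b sys)" for t
    using that by (auto simp: prepend_def defs)
  have eq'': "prepend p\<^sub>0 p t = P t" if "t \<ge> 1 - int (n_r sys)" for t
    using that by (auto simp: prepend_def defs)
  have "lpv_eq sys (prepend p\<^sub>0 p) (prepend u\<^sub>0 u) (prepend y\<^sub>0 y) k" if "k \<ge> 1" for k
    using sol that eq eq' eq'' lpv_eq_cong[of k sys "prepend p\<^sub>0 p" P "prepend u\<^sub>0 u" U "prepend y\<^sub>0 y" Y]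
    by (auto simp: lpv_sol_def)
  then show "solves sys (y\<^sub>0, p\<^sub>0, u\<^sub>0) (u, p, y)"
    using sol by (subst solves_iff) (auto simp: eq eq' lpv_sol_def)
qed

section \<open>State-space trajectories\<close>

text \<open>The scheduling is frozen into time-dependent matrices. What remains is a linear
  time-varying system.\<close>

definition ss_sol :: "nat \<Rightarrow> nat \<Rightarrow> nat \<Rightarrow> (int \<Rightarrow> real mat) \<Rightarrow> (int \<Rightarrow> real mat) \<Rightarrow> (int \<Rightarrow> real mat) \<Rightarrow>
    (int \<Rightarrow> real mat) \<Rightarrow> signal \<Rightarrow> signal \<Rightarrow> signal \<Rightarrow> bool" where
  "ss_sol n nu ny A B C D x u y \<longleftrightarrow> (\<forall>k\<ge>1::int.
     x k \<in> carrier_vec n \<and> u k \<in> carrier_vec nu \<and> y k \<in> carrier_vec ny \<and>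
     x (k + 1) = A k *\<^sub>v x k + B k *\<^sub>v u k \<and> y k = C k *\<^sub>v x k + D k *\<^sub>v u k)"

lemma mult_mat_sig_comb:
  assumes "M \<in> carrier_mat a b" "\<And>q. q \<in> J \<Longrightarrow> v q k \<in> carrier_vec b"
  shows "M *\<^sub>v sig_comb b J c v k = sig_comb a J c (\<lambda>q k. M *\<^sub>v v q k) k"
proof (intro eq_vecI)
  fix r assume "r < dim_vec (sig_comb a J c (\<lambda>q k. M *\<^sub>v v q k) k)"
  then have r: "r < a" by (simp add: sig_comb_def)
  have "(M *\<^sub>v sig_comb b J c v k) $ r = (\<Sum>i<b. \<Sum>q\<in>J. c q * (M $$ (r, i) * v q k $ i))"
    using assms(1) r by (simp add: sig_comb_def scalar_prod_def atLeast0LessThan sum_distrib_left mult.left_commute)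
  also have "\<dots> = (\<Sum>q\<in>J. c q * (\<Sum>i<b. M $$ (r, i) * v q k $ i))"
    unfolding sum_distrib_left by (rule sum.swap)
  also have "\<dots> = (\<Sum>q\<in>J. c q * (M *\<^sub>v v q k) $ r)"
    using assms r by (intro sum.cong refl) (simp add: scalar_prod_def atLeast0LessThan carrier_vecD[OF assms(2)])
  finally show "(M *\<^sub>v sig_comb b J c v k) $ r = sig_comb a J c (\<lambda>q k. M *\<^sub>v v q k) k $ r"
    using r by (simp add: sig_comb_def)
qed (use assms in \<open>simp add: sig_comb_def\<close>)

lemma sig_comb_add:
  assumes "\<And>q. q \<in> J \<Longrightarrow> v q k \<in> carrier_vec d" "\<And>q. q \<in> J \<Longrightarrow> w q k \<in> carrier_vec d"
  shows "sig_comb d J c v k + sig_comb d J c w k = sig_comb d J c (\<lambda>q k. v q k + w q k) k"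
proof (intro eq_vecI)
  fix r assume "r < dim_vec (sig_comb d J c (\<lambda>q k. v q k + w q k) k)"
  then have r: "r < d" by (simp add: sig_comb_def)
  then have "(\<Sum>q\<in>J. c q * (v q k + w q k) $ r) = (\<Sum>q\<in>J. c q * v q k $ r + c q * w q k $ r)"
    by (intro sum.cong refl) (simp add: carrier_vecD[OF assms(2)] algebra_simps)
  with r show "(sig_comb d J c v k + sig_comb d J c w k) $ r = sig_comb d J c (\<lambda>q k. v q k + w q k) k $ r"
    by (simp add: sig_comb_def sum.distrib)
qed (simp add: sig_comb_def)

lemma sig_comb_cong:
  assumes "\<And>q. q \<in> J \<Longrightarrow> v q k = w q k'"
  shows "sig_comb d J c v k = sig_comb d J c w k'"
  using assms by (auto simp: sig_comb_def intro!: eq_vecI sum.cong)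

text \<open>All summands share the same matrices, that is, one scheduling; state update and output
  equation then pass through the combination.\<close>

lemma ss_sol_sig_comb:
  assumes A: "\<And>k. k \<ge> 1 \<Longrightarrow> A k \<in> carrier_mat n n" and B: "\<And>k. k \<ge> 1 \<Longrightarrow> B k \<in> carrier_mat n nu"
    and C: "\<And>k. k \<ge> 1 \<Longrightarrow> C k \<in> carrier_mat ny n" and D: "\<And>k. k \<ge> 1 \<Longrightarrow> D k \<in> carrier_mat ny nu"
    and sol: "\<And>q. q \<in> J \<Longrightarrow> ss_sol n nu ny A B C D (x q) (u q) (y q)"
  shows "ss_sol n nu ny A B C D (sig_comb n J c x) (sig_comb nu J c u) (sig_comb ny J c y)"
  unfolding ss_sol_def
proof (intro allI impI conjI)
  fix k :: int assume k: "k \<ge> 1"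
  have s: "x q k \<in> carrier_vec n" "u q k \<in> carrier_vec nu"
    "x q (k + 1) = A k *\<^sub>v x q k + B k *\<^sub>v u q k" "y q k = C k *\<^sub>v x q k + D k *\<^sub>v u q k" if "q \<in> J" for q
    using sol[OF that] k by (auto simp: ss_sol_def)
  show "sig_comb n J c x (k + 1) = A k *\<^sub>v sig_comb n J c x k + B k *\<^sub>v sig_comb nu J c u k"
    using s k by (simp add: mult_mat_sig_comb[OF A] mult_mat_sig_comb[OF B]
        sig_comb_add mult_mat_vec_carrier[OF A] mult_mat_vec_carrier[OF B] cong: sig_comb_cong)
  show "sig_comb ny J c y k = C k *\<^sub>v sig_comb n J c x k + D k *\<^sub>v sig_comb nu J c u k"
    using s k by (simp add: mult_mat_sig_comb[OF C] mult_mat_sig_comb[OF D]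
        sig_comb_add mult_mat_vec_carrier[OF C] mult_mat_vec_carrier[OF D] cong: sig_comb_cong)
qed (rule sig_comb_carrier)+

text \<open>Induction on the state: its update at time \<open>i\<close> uses only state and input at
  \<open>i\<close>. Equal states and inputs then give equal outputs.\<close>

lemma ss_sol_unique:
  assumes s: "ss_sol n nu ny A B C D x u y" "ss_sol n nu ny A B C D x' u' y'"
    and init: "x 1 = x' 1" and u: "\<And>k. k \<in> {1..L} \<Longrightarrow> u k = u' k" and k: "k \<in> {1..L}"
  shows "y k = y' k"
proof -
  have "k \<ge> 1" using k by simp
  then have "k \<le> L \<longrightarrow> x k = x' k"
  proof (induction k rule: int_ge_induct)
    case (step i)
    then show ?case using s u[of i] by (auto simp: ss_sol_def)
  qed (simp add: init)
  then show ?thesis using s u k by (auto simp: ss_sol_def)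
qed

lemma ss_behavior_iff:
  assumes "p \<in> adm_sched sys"
  shows "(restrict u {1..}, p, restrict y {1..}) \<in> ss_behavior sys n A B C D \<longleftrightarrow>
    (\<exists>x. ss_sol n (n_u sys) (n_y sys) (\<lambda>k. A (p k)) (\<lambda>k. B (p k)) (\<lambda>k. C (p k)) (\<lambda>k. D (p k)) x u y)"
    (is "?l \<longleftrightarrow> ?r")
proof
  assume ?l
  then obtain x where x: "x \<in> {1..} \<rightarrow>\<^sub>E carrier_vec n"
    and ss: "\<And>k. k \<ge> 1 \<Longrightarrow> x (k + 1) = A (p k) *\<^sub>v x k + B (p k) *\<^sub>v u k \<and> y k = C (p k) *\<^sub>v x k + D (p k) *\<^sub>v u k"
    and u: "restrict u {1..} \<in> {1..} \<rightarrow>\<^sub>E carrier_vec (n_u sys)"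
    and y: "restrict y {1..} \<in> {1..} \<rightarrow>\<^sub>E carrier_vec (n_y sys)"
    by (auto simp: ss_behavior_def trajectories_def)
  have "x k \<in> carrier_vec n \<and> u k \<in> carrier_vec (n_u sys) \<and> y k \<in> carrier_vec (n_y sys)" if "k \<ge> 1" for k
    using PiE_mem[OF x, of k] PiE_mem[OF u, of k] PiE_mem[OF y, of k] that by simp
  with ss show ?r unfolding ss_sol_def by blast
next
  assume ?r
  then obtain x where x: "ss_sol n (n_u sys) (n_y sys) (\<lambda>k. A (p k)) (\<lambda>k. B (p k)) (\<lambda>k. C (p k)) (\<lambda>k. D (p k)) x u y"
    by blast
  then have "x k \<in> carrier_vec n" "u k \<in> carrier_vec (n_u sys)" "y k \<in> carrier_vec (n_y sys)" if "k \<ge> 1" for k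
    using that unfolding ss_sol_def by blast+
  then have "restrict x {1..} \<in> {1..} \<rightarrow>\<^sub>E carrier_vec n"
    "restrict u {1..} \<in> {1..} \<rightarrow>\<^sub>E carrier_vec (n_u sys)" "restrict y {1..} \<in> {1..} \<rightarrow>\<^sub>E carrier_vec (n_y sys)"
    by simp_all
  moreover have "\<forall>k\<ge>1. restrict x {1..} (k + 1) = A (p k) *\<^sub>v restrict x {1..} k + B (p k) *\<^sub>v restrict u {1..} k
      \<and> restrict y {1..} k = C (p k) *\<^sub>v restrict x {1..} k + D (p k) *\<^sub>v restrict u {1..} k"
    using x by (simp add: ss_sol_def)
  ultimately show ?l using assms unfolding ss_behavior_def trajectories_def by blast
qed

lemma window_combI:
  "i < d \<Longrightarrow> window_comb d m g w k $ i = (\<Sum>q<m. g $ q * w (k + int q) $ i)"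
  by (simp add: window_comb_def sig_comb_def)

text \<open>Entry 0 of the scheduling is the constant 1, for which the identity is the definition of
  the combined signal; entry \<open>j > 0\<close> is component \<open>j - 1\<close>, covered by the
  kernel identities.\<close>

lemma sched_entry_comb:
  assumes ker: "\<And>j. j < n \<Longrightarrow> (\<Sum>q<m. g $ q * (p (t + int q) $ j * w (t + int q) $ c)) = pb $ j * window_comb d m g w t $ c"
    and "j \<le> n" "c < d"
  shows "(\<Sum>q<m. g $ q * (sched_entry (p (t + int q)) j * w (t + int q) $ c)) = sched_entry pb j * window_comb d m g w t $ c"
  using assms(2,3) ker[of "j - 1"] by (cases "j = 0") (auto simp: sched_entry_def window_combI)

section \<open>Combinations of data windows\<close>

lemma moment_shift: "(\<lambda>t. moment P w (t + s)) = moment (\<lambda>t. P (t + s)) (\<lambda>t. w (t + s))"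
  by (simp add: moment_def fun_eq_iff)

lemma lpv_sol_adm:
  assumes "lpv_system sys" "lpv_sol sys P U Y" "t \<ge> 1 - int (n_r sys)"
  shows "P t \<in> sched_set sys"
proof (cases "t \<ge> 1")
  case True
  have "restrict P {1..} \<in> {1..} \<rightarrow>\<^sub>E sched_set sys"
    using assms unfolding lpv_system_def lpv_sol_def by blast
  from PiE_mem[OF this, of t] True show ?thesis by simp
qed (use assms in \<open>auto simp: lpv_sol_def\<close>)

lemma adm_sched_mem:
  assumes "lpv_system sys" "p \<in> adm_sched sys" "k \<ge> 1"
  shows "p k \<in> sched_set sys" "p k \<in> carrier_vec (n_p sys)"
proof -
  have "p \<in> {1..} \<rightarrow>\<^sub>E sched_set sys" using assms by (auto simp: lpv_system_def)
  from PiE_mem[OF this, of k] assms show "p k \<in> sched_set sys" "p k \<in> carrier_vec (n_p sys)"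
    by (auto simp: lpv_system_def)
qed

text \<open>The data carry a past, contained in \<open>P\<^sub>d\<close>, \<open>U\<^sub>d\<close>,
  \<open>Y\<^sub>d\<close>, that the Hankel matrices do not see. Likewise the scheduling on
  \<open>[1, L]\<close> is given through an admissible extension \<open>p'\<close>.\<close>

locale lpv_data =
  fixes sys :: lpv_io and L N :: nat and P\<^sub>d U\<^sub>d Y\<^sub>d p' :: signal
  assumes sys: "lpv_system sys" and sol: "lpv_sol sys P\<^sub>d U\<^sub>d Y\<^sub>d" and LN: "L < N"
    and adm: "p' \<in> adm_sched sys"
begin

abbreviation "nu \<equiv> n_u sys"
abbreviation "ny \<equiv> n_y sys"
abbreviation "m \<equiv> N - L + 1"
abbreviation "u \<equiv> trunc N U\<^sub>d"
abbreviation "p \<equiv> trunc N P\<^sub>d"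
abbreviation "y \<equiv> trunc N Y\<^sub>d"
abbreviation "kern \<equiv> mat_kernel (sched_rows sys L N u p y (trunc L p'))"
abbreviation "uc g \<equiv> window_comb nu m g u"
abbreviation "yc g \<equiv> window_comb ny m g y"

lemma data_carrier:
  shows "k \<in> {1..int L} \<Longrightarrow> trunc L p' k \<in> carrier_vec (n_p sys)"
    and "k \<in> {1..int N} \<Longrightarrow> p k \<in> carrier_vec (n_p sys)"
    and "k \<in> {1..int N} \<Longrightarrow> u k \<in> carrier_vec nu"
    and "k \<in> {1..int N} \<Longrightarrow> y k \<in> carrier_vec ny"
proof -
  have s: "sched_set sys \<subseteq> carrier_vec (n_p sys)" using sys by (simp add: lpv_system_def)
  show "k \<in> {1..int L} \<Longrightarrow> trunc L p' k \<in> carrier_vec (n_p sys)"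
    using adm_sched_mem[OF sys adm] by (simp add: trunc_def)
  show "k \<in> {1..int N} \<Longrightarrow> p k \<in> carrier_vec (n_p sys)"
    using lpv_sol_adm[OF sys sol, of k] s by (auto simp: trunc_def)
  show "k \<in> {1..int N} \<Longrightarrow> u k \<in> carrier_vec nu" "k \<in> {1..int N} \<Longrightarrow> y k \<in> carrier_vec ny"
    using sol by (auto simp: trunc_def lpv_sol_def)
qed

sublocale hankel_data sys L N u p y "trunc L p'"
  by unfold_locales (use LN data_carrier in blast)+

lemma kern_carrier: "g \<in> kern \<Longrightarrow> g \<in> carrier_vec m"
  using mat_kernel_carrier[OF sched_rows_carrier] by blast

lemma window_index: "t \<in> {1..int L} \<Longrightarrow> q < m \<Longrightarrow> t + int q \<in> {1..int N}"
  using LN by auto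

text \<open>The link from kernel to dynamics: moments under the data scheduling combine to moments
  under \<open>p'\<close>. The link exists on \<open>[1, L]\<close> only; earlier times need a
  separate argument each time.\<close>

lemma moment_comb:
  assumes g: "g \<in> kern" and t: "t \<in> {1..int L}" and j: "j \<le> n_p sys"
  shows "c < nu \<Longrightarrow> (\<Sum>q<m. g $ q * moment (\<lambda>t. P\<^sub>d (t + int q)) (\<lambda>t. U\<^sub>d (t + int q)) t j c) = moment p' (uc g) t j c"
    and "c < ny \<Longrightarrow> (\<Sum>q<m. g $ q * moment (\<lambda>t. P\<^sub>d (t + int q)) (\<lambda>t. Y\<^sub>d (t + int q)) t j c) = moment p' (yc g) t j c"
proof -
  note k = sched_rows_kernel_iff[THEN iffD1, OF kern_carrier[OF g] g]
  have tr: "trunc N w (t + int q) = w (t + int q)" if "q < m" for w q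
    using window_index[OF t that] by (simp add: trunc_def)
  have tL: "trunc L p' t = p' t" using t by (simp add: trunc_def)
  show "(\<Sum>q<m. g $ q * moment (\<lambda>t. P\<^sub>d (t + int q)) (\<lambda>t. U\<^sub>d (t + int q)) t j c) = moment p' (uc g) t j c"
    if c: "c < nu"
  proof -
    have "(\<Sum>q<m. g $ q * moment (\<lambda>t. P\<^sub>d (t + int q)) (\<lambda>t. U\<^sub>d (t + int q)) t j c)
        = (\<Sum>q<m. g $ q * (sched_entry (p (t + int q)) j * u (t + int q) $ c))"
      by (intro sum.cong refl) (simp only: moment_def tr lessThan_iff)
    also have "\<dots> = sched_entry (p' t) j * uc g t $ c"
      using k t c tL by (intro sched_entry_comb[OF _ j c]) auto
    finally show ?thesis by (simp only: moment_def)
  qed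
  show "(\<Sum>q<m. g $ q * moment (\<lambda>t. P\<^sub>d (t + int q)) (\<lambda>t. Y\<^sub>d (t + int q)) t j c) = moment p' (yc g) t j c"
    if c: "c < ny"
  proof -
    have "(\<Sum>q<m. g $ q * moment (\<lambda>t. P\<^sub>d (t + int q)) (\<lambda>t. Y\<^sub>d (t + int q)) t j c)
        = (\<Sum>q<m. g $ q * (sched_entry (p (t + int q)) j * y (t + int q) $ c))"
      by (intro sum.cong refl) (simp only: moment_def tr lessThan_iff)
    also have "\<dots> = sched_entry (p' t) j * yc g t $ c"
      using k t c tL by (intro sched_entry_comb[OF _ j c]) auto
    finally show ?thesis by (simp only: moment_def)
  qed
qed

lemma window_eq:
  assumes k: "k \<ge> 1"
  shows "lpv_eq sys (\<lambda>t. P\<^sub>d (t + int q)) (\<lambda>t. U\<^sub>d (t + int q)) (\<lambda>t. Y\<^sub>d (t + int q)) k"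
proof -
  have "lpv_eq sys P\<^sub>d U\<^sub>d Y\<^sub>d (k + int q)" using sol k by (simp add: lpv_sol_def)
  then show ?thesis by (simp add: lpv_eq_def drive_shift moment_shift)
qed

text \<open>Adds up the equations of the windows. The moments on the right are still those of the
  data under the data scheduling, past times included.\<close>

lemma yc_drive:
  assumes t: "k \<in> {1..int L}" and r: "r < ny"
  shows "yc g k $ r = drive sys
    (\<lambda>t j c. \<Sum>q<m. g $ q * moment (\<lambda>t. P\<^sub>d (t + int q)) (\<lambda>t. U\<^sub>d (t + int q)) t j c)
    (\<lambda>t j c. \<Sum>q<m. g $ q * moment (\<lambda>t. P\<^sub>d (t + int q)) (\<lambda>t. Y\<^sub>d (t + int q)) t j c) k r"
proof -
  have "yc g k $ r = (\<Sum>q<m. g $ q * Y\<^sub>d (k + int q) $ r)"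
    unfolding window_combI[OF r] using window_index[OF t] by (intro sum.cong refl) (simp add: trunc_def)
  also have "\<dots> = (\<Sum>q<m. g $ q * drive sys (moment (\<lambda>t. P\<^sub>d (t + int q)) (\<lambda>t. U\<^sub>d (t + int q)))
      (moment (\<lambda>t. P\<^sub>d (t + int q)) (\<lambda>t. Y\<^sub>d (t + int q))) k r)"
    using window_eq[of k] t r by (simp add: lpv_eq_def)
  finally show ?thesis unfolding drive_sum .
qed

text \<open>Combined windows that vanish on the first \<open>\<tau> \<ge> n\<^sub>r\<close> steps never see the past of the windows.\<close>

lemma zero_head_in_io_behavior:
  assumes g: "g \<in> kern" and \<tau>: "n_r sys \<le> \<tau>"
    and zero: "\<And>k. k \<in> {1..int \<tau>} \<Longrightarrow> uc g k = 0\<^sub>v nu" "\<And>k. k \<in> {1..int \<tau>} \<Longrightarrow> yc g k = 0\<^sub>v ny"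
  shows "(trunc L (uc g), trunc L (yc g)) \<in> io_behavior_zero_trunc sys L"
proof -
  \<comment> \<open>Past signals are zero, so the past scheduling is free; \<open>p' 1\<close> is at
    hand as an element of the scheduling set.\<close>
  define P where "P t = (if t \<le> 0 then p' 1 else p' t)" for t
  define U where "U t = (if t \<in> {1..int L} then uc g t else 0\<^sub>v nu)" for t
  define Y\<^sub>0 where "Y\<^sub>0 t = (if t \<ge> 1 then yc g t else 0\<^sub>v ny)" for t
  \<comment> \<open>A truncated trajectory has to come from an infinite one: after \<open>L\<close>
    the input is zero and the output follows the equation.\<close>
  obtain Y where Y: "\<And>k. k \<le> int L \<Longrightarrow> Y k = Y\<^sub>0 k"
    "\<And>k. k > int L \<Longrightarrow> Y k \<in> carrier_vec ny" "\<And>k. k > int L \<Longrightarrow> lpv_eq sys P U Y k"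
    using lpv_eq_extend[of "int L" Y\<^sub>0 sys P U] by blast
  have P1: "restrict P {1..} = p'"
  proof -
    have "p' \<in> extensional {1..}" using sys adm by (auto simp: lpv_system_def PiE_def)
    then show ?thesis by (auto simp: P_def restrict_def extensional_def fun_eq_iff)
  qed
  have eq: "lpv_eq sys P U Y k" if k: "k \<ge> 1" for k
  proof -
    \<comment> \<open>Beyond \<open>L\<close> the continuation satisfies the equation, and up to
      \<open>\<tau>\<close> everything is zero. In between, \<open>k > \<tau> \<ge> n_r\<close>
      keeps every delayed time at least 1, inside the reach of \<open>moment_comb\<close>.\<close>
    consider "k > int L" | "k \<le> int \<tau>" "k \<le> int L" | "k > int \<tau>" "k \<le> int L" by linarith
    then show ?thesis
    proof cases
      case 1
      then show ?thesis by (rule Y(3))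
    next
      case 2
      have U0: "U t = 0\<^sub>v nu" and Y0: "Y t = 0\<^sub>v ny" if "t \<le> k" for t
        using zero[of t] that 2 by (auto simp: U_def Y Y\<^sub>0_def)
      have "drive sys (moment P U) (moment P Y) k r = drive sys (\<lambda>_ _ _. 0) (\<lambda>_ _ _. 0) k r" for r
        by (rule drive_cong) (auto simp: moment_def U0 Y0)
      then show ?thesis by (simp add: lpv_eq_def Y0 drive_def)
    next
      case 3
      have "yc g k $ r = drive sys (moment P U) (moment P Y) k r" if r: "r < ny" for r
      proof -
        have k': "k \<in> {1..int L}" using k 3 by simp
        have rng: "t \<in> {1..int L}" if "k - int (n_r sys) \<le> t" "t \<le> k" for t
          using that 3 \<tau> by auto
        show ?thesis
          unfolding yc_drive[OF k' r]
        proof (rule drive_cong)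
          fix t :: int and j c :: nat
          assume "k - int (n_b sys) \<le> t" "t \<le> k" and jc: "j \<le> n_p sys" "c < nu"
          then have t: "t \<in> {1..int L}" by (intro rng) (auto simp: n_r_def)
          then show "(\<Sum>q<m. g $ q * moment (\<lambda>t. P\<^sub>d (t + int q)) (\<lambda>t. U\<^sub>d (t + int q)) t j c) = moment P U t j c"
            unfolding moment_comb(1)[OF g t jc] by (simp add: moment_def P_def U_def)
        next
          fix t :: int and j c :: nat
          assume "k - int (n_a sys) \<le> t" "t < k" and jc: "j \<le> n_p sys" "c < ny"
          then have t: "t \<in> {1..int L}" by (intro rng) (auto simp: n_r_def)
          then show "(\<Sum>q<m. g $ q * moment (\<lambda>t. P\<^sub>d (t + int q)) (\<lambda>t. Y\<^sub>d (t + int q)) t j c) = moment P Y t j c"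
            unfolding moment_comb(2)[OF g t jc] by (simp add: moment_def P_def Y Y\<^sub>0_def)
        qed
      qed
      then show ?thesis using 3 k by (simp add: lpv_eq_def Y Y\<^sub>0_def)
    qed
  qed
  have "lpv_sol sys P U Y"
    unfolding lpv_sol_def P1
  proof (intro conjI allI impI ballI)
    show "Y t \<in> carrier_vec ny" for t using Y by (cases "t \<le> int L") (auto simp: Y\<^sub>0_def)
  qed (use adm eq adm_sched_mem[OF sys adm, of 1] in \<open>auto simp: U_def P_def\<close>)
  note s = solves_of_lpv_sol[OF this]
  let ?w0 = "(restrict Y {1 - int (n_a sys)..0}, restrict P {1 - int (n_r sys)..0}, restrict U {1 - int (n_b sys)..0})"
  have "?w0 \<in> zero_initial_conditions sys"
    using s(2) by (auto simp: zero_initial_conditions_def Y Y\<^sub>0_def U_def)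
  then have "(trunc L (restrict U {1..}), trunc L (restrict Y {1..})) \<in> io_behavior_zero_trunc sys L"
    unfolding io_behavior_zero_trunc_def using s
    by (intro image_eqI[of _ _ "(restrict U {1..}, restrict P {1..}, restrict Y {1..})"]) (auto simp del: solves.simps)
  moreover have "trunc L (restrict U {1..}) = trunc L (uc g)" "trunc L (restrict Y {1..}) = trunc L (yc g)"
    by (auto simp: trunc_def restrict_def fun_eq_iff U_def Y Y\<^sub>0_def)
  ultimately show ?thesis by simp
qed

text \<open>The data windows run under the data scheduling, so they are not trajectories under
  \<open>p'\<close>. Restarting each from its own past under \<open>p'\<close> with its own input
  changes the individual outputs but not their combination; the restarted windows share one
  scheduling, where linearity is available.\<close>

lemma comb_in_ss_sol:
  assumes g: "g \<in> kern" and beh: "ss_behavior sys n A B C D = behavior sys"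
    and car: "A \<in> sched_set sys \<rightarrow> carrier_mat n n" "B \<in> sched_set sys \<rightarrow> carrier_mat n nu"
      "C \<in> sched_set sys \<rightarrow> carrier_mat ny n" "D \<in> sched_set sys \<rightarrow> carrier_mat ny nu"
  obtains x U Y where "ss_sol n nu ny (\<lambda>k. A (p' k)) (\<lambda>k. B (p' k)) (\<lambda>k. C (p' k)) (\<lambda>k. D (p' k)) x U Y"
    "\<And>k. k \<in> {1..int L} \<Longrightarrow> U k = uc g k" "\<And>k. k \<in> {1..int L} \<Longrightarrow> Y k = yc g k"
proof -
  \<comment> \<open>Window \<open>q\<close> keeps its own past, scheduling included, and switches to
    \<open>p'\<close> at time 1. Past moments thus stay those of the data.\<close>
  define P where "P q t = (if t \<le> 0 then P\<^sub>d (t + int q) else p' t)" for q :: nat and t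
  define U where "U q t = (if t \<le> int L then U\<^sub>d (t + int q) else 0\<^sub>v nu)" for q :: nat and t
  have "\<exists>Y. (\<forall>t\<le>0. Y t = Y\<^sub>d (t + int q)) \<and> (\<forall>t>0. Y t \<in> carrier_vec ny \<and> lpv_eq sys (P q) (U q) Y t)" for q
    by (rule lpv_eq_extend[of 0 "\<lambda>t. Y\<^sub>d (t + int q)" sys "P q" "U q"]) blast
  then obtain Y where Y: "\<And>q t. t \<le> 0 \<Longrightarrow> Y q t = Y\<^sub>d (t + int q)"
    "\<And>q t. t > 0 \<Longrightarrow> Y q t \<in> carrier_vec ny" "\<And>q t. t > 0 \<Longrightarrow> lpv_eq sys (P q) (U q) (Y q) t"
    by metis
  have P1: "restrict (P q) {1..} = p'" for q
  proof -
    have "p' \<in> extensional {1..}" using sys adm by (auto simp: lpv_system_def PiE_def)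
    then show ?thesis by (auto simp: P_def restrict_def extensional_def fun_eq_iff)
  qed
  have "lpv_sol sys (P q) (U q) (Y q)" for q
    unfolding lpv_sol_def P1
  proof (intro conjI allI impI ballI)
    show "Y q t \<in> carrier_vec ny" if "1 - int (n_a sys) \<le> t" for t
      using Y[of t] sol that by (cases "t \<le> 0") (auto simp: lpv_sol_def)
    show "U q t \<in> carrier_vec nu" if "1 - int (n_b sys) \<le> t" for t
      using sol that by (auto simp: U_def lpv_sol_def)
    show "P q t \<in> sched_set sys" if "t \<in> {1 - int (n_r sys)..0}" for t
      using lpv_sol_adm[OF sys sol, of "t + int q"] that by (auto simp: P_def)
    show "lpv_eq sys (P q) (U q) (Y q) k" if "1 \<le> k" for k using Y(3) that by simp
  qed (rule adm)
  note s = solves_of_lpv_sol[OF this]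
  have "(restrict (U q) {1..}, p', restrict (Y q) {1..}) \<in> ss_behavior sys n A B C D" for q
    using s[of q] unfolding beh behavior_def P1 by blast
  \<comment> \<open>The restarted windows lie in the behavior, so the realization supplies each with
    a state.\<close>
  then have "\<exists>x. ss_sol n nu ny (\<lambda>k. A (p' k)) (\<lambda>k. B (p' k)) (\<lambda>k. C (p' k)) (\<lambda>k. D (p' k)) x (U q) (Y q)" for q
    unfolding ss_behavior_iff[OF adm] .
  then obtain x where x: "ss_sol n nu ny (\<lambda>k. A (p' k)) (\<lambda>k. B (p' k)) (\<lambda>k. C (p' k)) (\<lambda>k. D (p' k)) (x q) (U q) (Y q)" for q
    by metis
  let ?c = "\<lambda>q. g $ q"
  have Uc: "sig_comb nu {..<m} ?c U k = uc g k" if k: "k \<in> {1..int L}" for k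
    unfolding window_comb_def using k window_index[OF k]
    by (intro sig_comb_cong) (auto simp: U_def trunc_def)
  \<comment> \<open>Strong induction over time. Both sides obey the same recursion: before time 1
    the moments agree window by window, and afterwards the combined moments agree by
    \<open>moment_comb\<close> and the induction hypothesis for earlier outputs.\<close>
  have Yc: "sig_comb ny {..<m} ?c Y k = yc g k" if "k \<in> {1..int L}" for k
    using that
  proof (induction "nat k" arbitrary: k rule: less_induct)
    case less
    note k = less.prems
    have "sig_comb ny {..<m} ?c Y k $ r = yc g k $ r" if r: "r < ny" for r
    proof -
      have "sig_comb ny {..<m} ?c Y k $ r = (\<Sum>q<m. g $ q * Y q k $ r)" using r by (simp add: sig_comb_def)
      also have "\<dots> = (\<Sum>q<m. g $ q * drive sys (moment (P q) (U q)) (moment (P q) (Y q)) k r)"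
        using Y(3)[of k] k r by (simp add: lpv_eq_def)
      also have "\<dots> = drive sys (\<lambda>t j c. \<Sum>q<m. g $ q * moment (P q) (U q) t j c)
          (\<lambda>t j c. \<Sum>q<m. g $ q * moment (P q) (Y q) t j c) k r"
        by (rule drive_sum[symmetric])
      also have "\<dots> = yc g k $ r"
        unfolding yc_drive[OF k r]
      proof (rule drive_cong)
        fix t :: int and j c :: nat
        assume t: "t \<le> k" and jc: "j \<le> n_p sys" "c < nu"
        show "(\<Sum>q<m. g $ q * moment (P q) (U q) t j c)
          = (\<Sum>q<m. g $ q * moment (\<lambda>t. P\<^sub>d (t + int q)) (\<lambda>t. U\<^sub>d (t + int q)) t j c)"
        proof (cases "t \<le> 0")
          case False
          then have t': "t \<in> {1..int L}" using t k by simp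
          have "(\<Sum>q<m. g $ q * moment (P q) (U q) t j c) = sched_entry (p' t) j * sig_comb nu {..<m} ?c U t $ c"
            using False jc by (simp add: moment_def P_def sig_comb_def sum_distrib_left mult.left_commute
                del: sum.lessThan_Suc)
          also have "\<dots> = moment p' (uc g) t j c" by (simp only: Uc[OF t'] moment_def)
          finally show ?thesis unfolding moment_comb(1)[OF g t' jc] .
        qed (simp add: moment_def P_def U_def)
      next
        fix t :: int and j c :: nat
        assume t: "t < k" and jc: "j \<le> n_p sys" "c < ny"
        show "(\<Sum>q<m. g $ q * moment (P q) (Y q) t j c)
          = (\<Sum>q<m. g $ q * moment (\<lambda>t. P\<^sub>d (t + int q)) (\<lambda>t. Y\<^sub>d (t + int q)) t j c)"
        proof (cases "t \<le> 0")
          case False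
          then have t': "t \<in> {1..int L}" using t k by simp
          have "(\<Sum>q<m. g $ q * moment (P q) (Y q) t j c) = sched_entry (p' t) j * sig_comb ny {..<m} ?c Y t $ c"
            using False jc by (simp add: moment_def P_def sig_comb_def sum_distrib_left mult.left_commute
                del: sum.lessThan_Suc)
          also have "sig_comb ny {..<m} ?c Y t = yc g t"
            using t t' by (intro less.hyps) auto
          finally show ?thesis unfolding moment_comb(2)[OF g t' jc] by (simp only: moment_def)
        qed (simp add: moment_def P_def Y)
      qed
      finally show ?thesis .
    qed
    then show ?case by (intro eq_vecI) (simp_all add: carrier_vecD[OF sig_comb_carrier] carrier_vecD[OF window_comb_carrier])
  qed
  have P'm: "p' k \<in> sched_set sys" if "k \<ge> 1" for k using adm_sched_mem[OF sys adm that] by simp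
  show ?thesis
  proof (rule that)
    show "ss_sol n nu ny (\<lambda>k. A (p' k)) (\<lambda>k. B (p' k)) (\<lambda>k. C (p' k)) (\<lambda>k. D (p' k))
      (sig_comb n {..<m} ?c x) (sig_comb nu {..<m} ?c U) (sig_comb ny {..<m} ?c Y)"
      using car P'm x by (intro ss_sol_sig_comb) auto
  qed (use Uc Yc in auto)
qed

end

section \<open>Dimension count: trajectories as combinations of data windows\<close>

lemma window_comb_mult_vec:
  assumes V: "V \<in> carrier_mat m d" and c: "c \<in> carrier_vec d"
  shows "window_comb n m (V *\<^sub>v c) w k = sig_comb n {..<d} (\<lambda>i. c $ i) (\<lambda>i. window_comb n m (col V i) w) k"
proof (intro eq_vecI)
  fix r assume "r < dim_vec (sig_comb n {..<d} (\<lambda>i. c $ i) (\<lambda>i. window_comb n m (col V i) w) k)"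
  then have r: "r < n" by (simp add: carrier_vecD[OF sig_comb_carrier])
  have "window_comb n m (V *\<^sub>v c) w k $ r = (\<Sum>q<m. \<Sum>i<d. c $ i * (V $$ (q, i) * w (k + int q) $ r))"
    unfolding window_combI[OF r]
    using V c by (intro sum.cong refl, simp add: scalar_prod_def atLeast0LessThan sum_distrib_right)
      (intro sum.cong refl, simp)
  also have "\<dots> = (\<Sum>i<d. \<Sum>q<m. c $ i * (V $$ (q, i) * w (k + int q) $ r))" by (rule sum.swap)
  also have "\<dots> = (\<Sum>i<d. c $ i * window_comb n m (col V i) w k $ r)"
    unfolding window_combI[OF r] sum_distrib_left using V by (intro sum.cong refl) simp
  finally show "window_comb n m (V *\<^sub>v c) w k $ r
      = sig_comb n {..<d} (\<lambda>i. c $ i) (\<lambda>i. window_comb n m (col V i) w) k $ r"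
    using r by (simp add: sig_comb_def)
qed (simp add: carrier_vecD[OF sig_comb_carrier] carrier_vecD[OF window_comb_carrier])

lemma stack_sig_comb:
  "stack d L (sig_comb d J c w) = vec (L * d) (\<lambda>r. \<Sum>q\<in>J. c q * stack d L (w q) $ r)"
proof (intro eq_vecI)
  fix r assume "r < dim_vec (vec (L * d) (\<lambda>r. \<Sum>q\<in>J. c q * stack d L (w q) $ r))"
  then have r: "r < L * d" by simp
  then have "r mod d < d" by (intro mod_less_divisor) (cases d, auto)
  with r show "stack d L (sig_comb d J c w) $ r = vec (L * d) (\<lambda>r. \<Sum>q\<in>J. c q * stack d L (w q) $ r) $ r"
    by (simp add: stack_def sig_comb_def)
qed (simp add: stack_def)

text \<open>A trajectory on \<open>[1, L]\<close> is determined by its initial state and input, so these trajectories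
  form a space of dimension at most \<open>n\<^sub>x + n\<^sub>u L\<close>; persistency of excitation says that the
  combinations of data windows already fill this dimension.\<close>

lemma (in lpv_data) trajectory_from_data:
  assumes order: "is_order sys nx" and pe: "persistently_exciting sys L nx N u p y"
    and beh: "(restrict v {1..}, p', restrict z {1..}) \<in> behavior sys"
  obtains g where "g \<in> kern" "\<And>k. k \<in> {1..int L} \<Longrightarrow> uc g k = v k" "\<And>k. k \<in> {1..int L} \<Longrightarrow> yc g k = z k"
proof -
  from order obtain A B C D where
    car: "A \<in> sched_set sys \<rightarrow> carrier_mat nx nx" "B \<in> sched_set sys \<rightarrow> carrier_mat nx nu"
      "C \<in> sched_set sys \<rightarrow> carrier_mat ny nx" "D \<in> sched_set sys \<rightarrow> carrier_mat ny nu"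
    and real: "ss_behavior sys nx A B C D = behavior sys"
    unfolding is_order_def has_ss_realization_def by blast
  let ?S = "ss_sol nx nu ny (\<lambda>k. A (p' k)) (\<lambda>k. B (p' k)) (\<lambda>k. C (p' k)) (\<lambda>k. D (p' k))"
  have car': "A (p' k) \<in> carrier_mat nx nx" "B (p' k) \<in> carrier_mat nx nu"
    "C (p' k) \<in> carrier_mat ny nx" "D (p' k) \<in> carrier_mat ny nu" if "k \<ge> 1" for k
    using car adm_sched_mem(1)[OF sys adm that] by auto
  note S_comb = ss_sol_sig_comb[of "\<lambda>k. A (p' k)" nx "\<lambda>k. B (p' k)" nu "\<lambda>k. C (p' k)" ny "\<lambda>k. D (p' k)", OF car']
  let ?H = "stacked_hankel sys L N u y"
  \<comment> \<open>The subspace whose dimension is prescribed by persistency of excitation. It lies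
    in the kernel, and the stacked Hankel matrix is injective on it.\<close>
  define W where "W = orth_proj_set kern (vec_space.row_space m ?H)"
  define d where "d = nx + L * nu"
  have dim: "subspace_dim m W = d"
    using pe adm by (auto simp: persistently_exciting_def adm_sched_trunc_def W_def d_def mult.commute)
  have Wk: "W \<subseteq> kern" by (auto simp: W_def orth_proj_set_def)
  note k_sub = vec_subspace_mat_kernel[OF sched_rows_carrier]
  have W_sub: "vec_subspace m W"
    unfolding W_def
    by (rule vec_subspace_orth_proj_set[OF k_sub vec_subspace_row_space[OF stacked_hankel_carrier]])
  obtain V where V: "V \<in> carrier_mat m d"
    and VW: "\<And>c. c \<in> carrier_vec d \<Longrightarrow> V *\<^sub>v c \<in> W"
    and Vinj: "\<And>c. c \<in> carrier_vec d \<Longrightarrow> V *\<^sub>v c = 0\<^sub>v m \<Longrightarrow> c = 0\<^sub>v d"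
    using subspace_dim_obtain_basis_mat[OF W_sub, unfolded dim] by blast
  \<comment> \<open>Columns of \<open>V\<close> are images of unit vectors, hence in
    \<open>W\<close> and in the kernel, so each yields a state-space trajectory.\<close>
  have "\<exists>x U Y. ?S x U Y \<and> (\<forall>k\<in>{1..int L}. U k = uc (col V i) k \<and> Y k = yc (col V i) k)" if "i < d" for i
  proof -
    have "V *\<^sub>v unit_vec d i = col V i" using V that by (intro eq_vecI) auto
    then have "col V i \<in> kern" using VW[of "unit_vec d i"] Wk by auto
    then obtain x U Y where "?S x U Y" "\<And>k. k \<in> {1..int L} \<Longrightarrow> U k = uc (col V i) k"
      "\<And>k. k \<in> {1..int L} \<Longrightarrow> Y k = yc (col V i) k"
      using comb_in_ss_sol[OF _ real car] by blast
    then show ?thesis by blast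
  qed
  then obtain x U Y where xUY: "\<And>i. i < d \<Longrightarrow> ?S (x i) (U i) (Y i)"
    "\<And>i k. i < d \<Longrightarrow> k \<in> {1..int L} \<Longrightarrow> U i k = uc (col V i) k \<and> Y i k = yc (col V i) k"
    by metis
  let ?x = "\<lambda>c. sig_comb nx {..<d} (\<lambda>i. c $ i) x"
  let ?U = "\<lambda>c. sig_comb nu {..<d} (\<lambda>i. c $ i) U"
  let ?Y = "\<lambda>c. sig_comb ny {..<d} (\<lambda>i. c $ i) Y"
  have S: "?S (?x c) (?U c) (?Y c)" for c
    by (rule S_comb) (use xUY(1) in auto)
  have x1: "x i 1 \<in> carrier_vec nx" if "i < d" for i
    using xUY(1)[OF that] by (simp add: ss_sol_def)
  have UY: "uc (V *\<^sub>v c) k = ?U c k" "yc (V *\<^sub>v c) k = ?Y c k"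
    if "c \<in> carrier_vec d" "k \<in> {1..int L}" for c k
    using xUY(2)[OF _ that(2)] unfolding window_comb_mult_vec[OF V that(1)]
    by (auto intro!: sig_comb_cong)
  \<comment> \<open>Maps coordinates to initial state and stacked input of the combined trajectory.
    Persistency of excitation makes it square, so injectivity will give surjectivity.\<close>
  define Z where "Z = mat d d (\<lambda>(r, i). (x i 1 @\<^sub>v stack nu L (U i)) $ r)"
  have Z: "Z \<in> carrier_mat d d" by (simp add: Z_def)
  have Zc: "Z *\<^sub>v c = ?x c 1 @\<^sub>v stack nu L (?U c)" if c: "c \<in> carrier_vec d" for c
  proof (intro eq_vecI)
    fix r assume "r < dim_vec (?x c 1 @\<^sub>v stack nu L (?U c))"
    then have r: "r < nx + L * nu" by (simp add: carrier_vecD[OF sig_comb_carrier] carrier_vecD[OF stack_carrier])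
    have "(Z *\<^sub>v c) $ r = (\<Sum>i<d. c $ i * (x i 1 @\<^sub>v stack nu L (U i)) $ r)"
      using c r by (simp add: Z_def d_def scalar_prod_def atLeast0LessThan mult.commute)
    also have "\<dots> = (?x c 1 @\<^sub>v stack nu L (?U c)) $ r"
    proof (cases "r < nx")
      case True
      then show ?thesis by (simp add: sig_comb_def carrier_vecD[OF x1])
    next
      case False
      with r have "r - nx < L * nu" by simp
      with False r show ?thesis
        by (simp add: carrier_vecD[OF x1] carrier_vecD[OF sig_comb_carrier] carrier_vecD[OF stack_carrier]
            stack_sig_comb)
    qed
    finally show "(Z *\<^sub>v c) $ r = (?x c 1 @\<^sub>v stack nu L (?U c)) $ r" .
  qed (simp add: Z_def d_def carrier_vecD[OF sig_comb_carrier] carrier_vecD[OF stack_carrier])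
  \<comment> \<open>Zero initial state and zero input force zero output. The combined windows then
    vanish, and injectivity of the Hankel matrix on \<open>W\<close> gives
    \<open>V *\<^sub>v c = 0\<^sub>v m\<close>.\<close>
  have Z_inj: "c = 0\<^sub>v d" if c: "c \<in> carrier_vec d" and "Z *\<^sub>v c = 0\<^sub>v d" for c
  proof -
    from that have "?x c 1 = 0\<^sub>v nx \<and> stack nu L (?U c) = 0\<^sub>v (L * nu)"
      unfolding Zc[OF c] d_def by (subst (asm) append_vec_eq_0_iff[OF sig_comb_carrier stack_carrier])
    then have x0: "?x c 1 = 0\<^sub>v nx" and U0: "\<And>k. k \<in> {1..int L} \<Longrightarrow> ?U c k = 0\<^sub>v nu"
      using stack_eq_0_iff[of L "?U c" nu] by simp_all
    have null: "sig_comb a {} e w k = 0\<^sub>v a" for a w k and e :: "nat \<Rightarrow> real"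
      by (intro eq_vecI) (simp_all add: sig_comb_def)
    \<comment> \<open>The zero solution arises as the empty combination.\<close>
    have S0: "?S (\<lambda>_. 0\<^sub>v nx) (\<lambda>_. 0\<^sub>v nu) (\<lambda>_. 0\<^sub>v ny)"
      using S_comb[of "{} :: nat set" x U Y "\<lambda>_. 0"] unfolding null[abs_def] by simp
    have Y0: "?Y c k = 0\<^sub>v ny" if "k \<in> {1..int L}" for k
      using ss_sol_unique[OF S S0 x0 U0 that] by simp
    have "?H *\<^sub>v (V *\<^sub>v c) = 0\<^sub>v (L * nu + L * ny)"
      unfolding stacked_hankel_mult_vec[OF mult_mat_vec_carrier[OF V c]]
        append_vec_eq_0_iff[OF stack_carrier stack_carrier] stack_eq_0_iff[OF window_comb_carrier]
      using UY[OF c] U0 Y0 by simp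
    then have "V *\<^sub>v c = 0\<^sub>v m"
      using orth_proj_row_space_inj[OF stacked_hankel_carrier vec_subspaceD(1)[OF k_sub]] VW[OF c] unfolding W_def by blast
    then show ?thesis by (rule Vinj[OF c])
  qed
  from beh obtain x' where x': "?S x' v z"
    unfolding real[symmetric] ss_behavior_iff[OF adm] by blast
  then have "x' 1 \<in> carrier_vec nx" and v: "\<And>k. k \<in> {1..int L} \<Longrightarrow> v k \<in> carrier_vec nu" by (auto simp: ss_sol_def)
  then have target: "x' 1 @\<^sub>v stack nu L v \<in> carrier_vec d" unfolding d_def by (intro append_carrier_vec stack_carrier)
  \<comment> \<open>Initial state and input of the target trajectory are matched here; its output
    then agrees by uniqueness.\<close>
  obtain c where c: "c \<in> carrier_vec d" "Z *\<^sub>v c = x' 1 @\<^sub>v stack nu L v"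
    using mat_surj_if_trivial_kernel[OF Z Z_inj target] by blast
  then have "?x c 1 = x' 1 \<and> stack nu L (?U c) = stack nu L v"
    unfolding Zc[OF c(1)] using append_vec_eq[OF sig_comb_carrier \<open>x' 1 \<in> carrier_vec nx\<close>] by blast
  then have xc: "?x c 1 = x' 1" and Uc: "\<And>k. k \<in> {1..int L} \<Longrightarrow> ?U c k = v k"
    using stack_eq_iff[of L "?U c" nu v] v by simp_all
  show ?thesis
  proof (rule that)
    show "V *\<^sub>v c \<in> kern" using VW[OF c(1)] Wk by blast
    show "uc (V *\<^sub>v c) k = v k" if "k \<in> {1..int L}" for k
      using UY(1)[OF c(1) that] Uc[OF that] by simp
    show "yc (V *\<^sub>v c) k = z k" if "k \<in> {1..int L}" for k
      using UY(2)[OF c(1) that] ss_sol_unique[OF S x' xc Uc that] by simp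
  qed
qed

section \<open>Delaying a trajectory with zero past\<close>

lemma adm_sched_delay:
  assumes shift: "adm_sched sys \<subseteq> signal_shift ` adm_sched sys" and q: "q \<in> adm_sched sys"
  shows "\<exists>p\<in>adm_sched sys. \<forall>k\<ge>1. p (k + int s) = q k"
proof (induction s)
  case (Suc s)
  then obtain p where p: "p \<in> adm_sched sys" "\<And>k. k \<ge> 1 \<Longrightarrow> p (k + int s) = q k" by blast
  \<comment> \<open>A preimage under the shift puts one more admissible value in front.\<close>
  from p(1) shift obtain p2 where p2: "p2 \<in> adm_sched sys" "p = signal_shift p2" by blast
  have "p2 (k + int (Suc s)) = q k" if "k \<ge> 1" for k
    using p(2)[OF that] that by (simp add: p2(2) signal_shift_def add_ac)
  with p2(1) show ?case by blast
qed (use q in auto)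

text \<open>Zero signals solve the equation under any scheduling. After the delay the equation sees
  the shifted trajectory, preceded by zeros where its zero initial condition was.\<close>

lemma lpv_sol_delay:
  assumes sys: "lpv_system sys" and sol: "lpv_sol sys P\<^sub>0 U\<^sub>0 Y\<^sub>0"
    and U0: "\<And>t. t \<in> {1 - int (n_b sys)..0} \<Longrightarrow> U\<^sub>0 t = 0\<^sub>v (n_u sys)"
    and Y0: "\<And>t. t \<in> {1 - int (n_a sys)..0} \<Longrightarrow> Y\<^sub>0 t = 0\<^sub>v (n_y sys)"
    and p: "p \<in> adm_sched sys" "\<And>k. k \<ge> 1 \<Longrightarrow> p (k + int s) = P\<^sub>0 k"
  defines "U \<equiv> \<lambda>t. if t \<le> int s then 0\<^sub>v (n_u sys) else U\<^sub>0 (t - int s)"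
    and "Y \<equiv> \<lambda>t. if t \<le> int s then 0\<^sub>v (n_y sys) else Y\<^sub>0 (t - int s)"
  shows "(restrict U {1..}, p, restrict Y {1..}) \<in> behavior sys"
proof -
  define P where "P t = (if t \<le> 0 then p 1 else p t)" for t
  have P1: "restrict P {1..} = p"
  proof -
    have "p \<in> extensional {1..}" using sys p by (auto simp: lpv_system_def PiE_def)
    then show ?thesis by (auto simp: P_def restrict_def extensional_def fun_eq_iff)
  qed
  have eq: "lpv_eq sys P U Y k" if k: "k \<ge> 1" for k
  proof (cases "k \<le> int s")
    case True
    have "drive sys (moment P U) (moment P Y) k r = drive sys (\<lambda>_ _ _. 0) (\<lambda>_ _ _. 0) k r" for r
      by (rule drive_cong) (use True in \<open>auto simp: moment_def U_def Y_def\<close>)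
    then show ?thesis using True by (simp add: lpv_eq_def Y_def drive_def)
  next
    case False
    have "drive sys (moment P U) (moment P Y) k r = drive sys (moment P\<^sub>0 U\<^sub>0) (moment P\<^sub>0 Y\<^sub>0) (k - int s) r" for r
    proof -
      have "drive sys (moment P U) (moment P Y) k r
          = drive sys (moment (\<lambda>t. P (t + int s)) (\<lambda>t. U (t + int s)))
              (moment (\<lambda>t. P (t + int s)) (\<lambda>t. Y (t + int s))) (k - int s) r"
        using drive_shift[of sys "moment P U" "moment P Y" "k - int s" "int s" r] by (simp add: moment_shift)
      also have "\<dots> = drive sys (moment P\<^sub>0 U\<^sub>0) (moment P\<^sub>0 Y\<^sub>0) (k - int s) r"
      proof (rule drive_cong)
        fix t :: int and j c :: nat
        assume "k - int s - int (n_b sys) \<le> t" "c < n_u sys"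
        \<comment> \<open>For \<open>t \<le> 0\<close> both moments vanish with the signal, although
          the schedulings may differ there; for \<open>t \<ge> 1\<close> the schedulings
          agree.\<close>
        then show "moment (\<lambda>t. P (t + int s)) (\<lambda>t. U (t + int s)) t j c = moment P\<^sub>0 U\<^sub>0 t j c"
          using False U0[of t] p(2)[of t] by (cases "t \<le> 0") (auto simp: moment_def U_def P_def)
      next
        fix t :: int and j c :: nat
        assume "k - int s - int (n_a sys) \<le> t" "c < n_y sys"
        then show "moment (\<lambda>t. P (t + int s)) (\<lambda>t. Y (t + int s)) t j c = moment P\<^sub>0 Y\<^sub>0 t j c"
          using False Y0[of t] p(2)[of t] by (cases "t \<le> 0") (auto simp: moment_def Y_def P_def)
      qed
      finally show ?thesis .
    qed
    moreover have "lpv_eq sys P\<^sub>0 U\<^sub>0 Y\<^sub>0 (k - int s)" using sol False by (simp add: lpv_sol_def)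
    ultimately show ?thesis using False by (simp add: lpv_eq_def Y_def)
  qed
  have "lpv_sol sys P U Y"
    unfolding lpv_sol_def P1
  proof (intro conjI allI impI ballI)
    show "U t \<in> carrier_vec (n_u sys)" for t using sol by (simp add: U_def lpv_sol_def)
    show "Y t \<in> carrier_vec (n_y sys)" for t using sol by (simp add: Y_def lpv_sol_def)
  qed (use p eq adm_sched_mem[OF sys p(1), of 1] in \<open>auto simp: P_def\<close>)
  from solves_of_lpv_sol[OF this] show ?thesis unfolding behavior_def P1 by blast
qed

lemma supply_sum_delay:
  assumes "r \<le> L" "\<And>k. k \<in> {1..int (L - r)} \<Longrightarrow> f k = 0"
    and "\<And>k. k \<in> {1..int r} \<Longrightarrow> f (k + int (L - r)) = (h k :: real)"
  shows "(\<Sum>k=1..int L. f k) = (\<Sum>k=1..int r. h k)"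
proof -
  have h: "h (k - int (L - r)) = f k" if "k \<in> {int (L - r) + 1..int L}" for k
    using assms(3)[of "k - int (L - r)"] that assms(1) by (simp add: of_nat_diff)
  have "(\<Sum>k=1..int L. f k) = (\<Sum>k\<in>{int (L - r) + 1..int L}. f k)"
    by (rule sum.mono_neutral_right) (use assms in auto)
  also have "\<dots> = (\<Sum>k=1..int r. h k)"
    by (rule sum.reindex_bij_witness[of _ "\<lambda>k. k + int (L - r)" "\<lambda>k. k - int (L - r)"])
      (use assms(1) h in \<open>auto simp: of_nat_diff\<close>)
  finally show ?thesis .
qed

section \<open>The two implications between dissipativity and the data condition\<close>

theorem theorem1:
  fixes sys :: lpv_io
    and u p y :: signal
    and L N :: nat
    and Q S R :: "real mat"
  assumes sys: "lpv_system sys"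
    and data: "(u, p, y) \<in> behavior_trunc sys N"
    and L: "1 \<le> L" "L < N"
    and Q: "Q \<in> carrier_mat (n_u sys) (n_u sys)" "transpose_mat Q = Q"
    and S: "S \<in> carrier_mat (n_u sys) (n_y sys)"
    and R: "R \<in> carrier_mat (n_y sys) (n_y sys)" "transpose_mat R = R"
  shows "(dissipative sys L Q S R \<longrightarrow>
           (\<forall>\<tau>. n_r sys \<le> \<tau> \<and> \<tau> < L \<longrightarrow>
             (\<forall>pbar \<in> adm_sched_trunc sys L. data_condition sys \<tau> L N u p y Q S R pbar))) \<and>
         (adm_sched sys \<subseteq> signal_shift ` adm_sched sys \<longrightarrow>
         (\<forall>n\<^sub>x. is_order sys n\<^sub>x \<and> persistently_exciting sys L n\<^sub>x N u p y \<longrightarrow>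
           (\<forall>\<tau>. 1 \<le> \<tau> \<and> \<tau> < L \<and>
              (\<forall>pbar \<in> adm_sched_trunc sys L. data_condition sys \<tau> L N u p y Q S R pbar) \<longrightarrow>
              dissipative sys (L - \<tau>) Q S R)))"
proof -
  have adm: "adm_sched sys \<subseteq> ({1..} \<rightarrow>\<^sub>E sched_set sys)" using sys by (simp add: lpv_system_def)
  from data obtain u\<^sub>1 p\<^sub>1 y\<^sub>1 where beh: "(u\<^sub>1, p\<^sub>1, y\<^sub>1) \<in> behavior sys"
    and upy\<^sub>1: "u = trunc N u\<^sub>1" "p = trunc N p\<^sub>1" "y = trunc N y\<^sub>1"
    by (auto simp: behavior_trunc_def)
  from beh obtain y\<^sub>0 p\<^sub>0 u\<^sub>0 where w0: "(u\<^sub>1, p\<^sub>1, y\<^sub>1) \<in> trajectories sys"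
    "(y\<^sub>0, p\<^sub>0, u\<^sub>0) \<in> initial_conditions sys" "solves sys (y\<^sub>0, p\<^sub>0, u\<^sub>0) (u\<^sub>1, p\<^sub>1, y\<^sub>1)"
    unfolding behavior_def by auto
  define P\<^sub>d where "P\<^sub>d = prepend p\<^sub>0 p\<^sub>1"
  define U\<^sub>d where "U\<^sub>d = prepend u\<^sub>0 u\<^sub>1"
  define Y\<^sub>d where "Y\<^sub>d = prepend y\<^sub>0 y\<^sub>1"
  have sol: "lpv_sol sys P\<^sub>d U\<^sub>d Y\<^sub>d"
    unfolding P\<^sub>d_def U\<^sub>d_def Y\<^sub>d_def by (rule lpv_sol_of_solves(1)[OF w0 adm])
  \<comment> \<open>Truncation keeps times 1 to \<open>N\<close> only, so gluing on the past leaves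
    the data unchanged.\<close>
  have upy: "u = trunc N U\<^sub>d" "p = trunc N P\<^sub>d" "y = trunc N Y\<^sub>d"
    by (auto simp: upy\<^sub>1 P\<^sub>d_def U\<^sub>d_def Y\<^sub>d_def trunc_def prepend_def restrict_def fun_eq_iff)
  have D: "lpv_data sys L N P\<^sub>d U\<^sub>d Y\<^sub>d p'" if "p' \<in> adm_sched sys" for p'
    using sys sol L(2) that by unfold_locales
  have i: "data_condition sys \<tau> L N u p y Q S R (trunc L p')"
    if diss: "dissipative sys L Q S R" and \<tau>: "n_r sys \<le> \<tau>" "\<tau> < L" and p': "p' \<in> adm_sched sys" for \<tau> p'
  proof -
    interpret lpv_data sys L N P\<^sub>d U\<^sub>d Y\<^sub>d p' by (rule D[OF p'])
    show ?thesis
      unfolding upy data_condition_iff[OF \<tau>(2) Q(1) S R(1)]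
    proof (intro ballI impI)
      fix g assume g: "g \<in> kern" and z: "\<forall>k\<in>{1..int \<tau>}. uc g k = 0\<^sub>v nu \<and> yc g k = 0\<^sub>v ny"
      have "(trunc L (uc g), trunc L (yc g)) \<in> io_behavior_zero_trunc sys L"
        by (rule zero_head_in_io_behavior[OF g \<tau>(1)]) (use z in auto)
      \<comment> \<open>Dissipativity is applied at the full horizon \<open>r = L\<close>, where the
        supply sum is the quadratic form.\<close>
      moreover have "L \<in> {1..L}" using L by simp
      ultimately have "(\<Sum>k=1..int L. supply_rate Q S R (trunc L (uc g) k) (trunc L (yc g) k)) \<ge> 0"
        using diss unfolding dissipative_def by blast
      then show "(\<Sum>k=1..int L. supply_rate Q S R (uc g k) (yc g k)) \<ge> 0"
        by (simp add: trunc_def)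
    qed
  qed
  have ii: "dissipative sys (L - \<tau>) Q S R"
    if shift: "adm_sched sys \<subseteq> signal_shift ` adm_sched sys" and order: "is_order sys nx"
      and pe: "persistently_exciting sys L nx N u p y" and \<tau>: "1 \<le> \<tau>" "\<tau> < L"
      and cond: "\<And>p'. p' \<in> adm_sched sys \<Longrightarrow> data_condition sys \<tau> L N u p y Q S R (trunc L p')" for nx \<tau>
    unfolding dissipative_def
  proof (intro ballI, clarify)
    fix r u' y' assume r: "r \<in> {1..L - \<tau>}" and "(u', y') \<in> io_behavior_zero_trunc sys (L - \<tau>)"
    then obtain v q z w where t: "(v, q, z) \<in> trajectories sys" "w \<in> zero_initial_conditions sys" "solves sys w (v, q, z)"
      and uy: "u' = trunc (L - \<tau>) v" "y' = trunc (L - \<tau>) z"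
      unfolding io_behavior_zero_trunc_def by auto
    obtain y\<^sub>2 p\<^sub>2 u\<^sub>2 where w: "w = (y\<^sub>2, p\<^sub>2, u\<^sub>2)" by (cases w)
    have w2: "(y\<^sub>2, p\<^sub>2, u\<^sub>2) \<in> initial_conditions sys" using t(2) by (simp add: w zero_initial_conditions_def)
    note sol2 = lpv_sol_of_solves(1)[OF t(1) w2 t(3)[unfolded w] adm]
    have q: "q \<in> adm_sched sys" using t(1) by (simp add: trajectories_def)
    \<comment> \<open>The delay moves the first \<open>r\<close> steps to the end of
      \<open>[1, L]\<close>. Since \<open>r \<le> L - \<tau>\<close>, at least \<open>\<tau>\<close>
      zeros precede them, as the data condition demands.\<close>
    define s where "s = L - r"
    have s: "\<tau> \<le> s" "r \<le> L" using r \<tau> by (auto simp: s_def)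
    \<comment> \<open>The scheduling is delayed together with the signals, so the data condition is
      used for \<open>p'\<close> instead of \<open>q\<close>.\<close>
    obtain p' where p': "p' \<in> adm_sched sys" "\<And>k. k \<ge> 1 \<Longrightarrow> p' (k + int s) = q k"
      using adm_sched_delay[OF shift q, of s] by blast
    define U where "U = (\<lambda>t. if t \<le> int s then 0\<^sub>v (n_u sys) else prepend u\<^sub>2 v (t - int s))"
    define Y where "Y = (\<lambda>t. if t \<le> int s then 0\<^sub>v (n_y sys) else prepend y\<^sub>2 z (t - int s))"
    interpret lpv_data sys L N P\<^sub>d U\<^sub>d Y\<^sub>d p' by (rule D[OF p'(1)])
    have "(restrict U {1..}, p', restrict Y {1..}) \<in> behavior sys"
      unfolding U_def Y_def
      by (rule lpv_sol_delay[OF sys sol2 _ _ p'(1)])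
        (use t(2) p'(2) in \<open>auto simp: w zero_initial_conditions_def prepend_def\<close>)
    then obtain g where g: "g \<in> kern" "\<And>k. k \<in> {1..int L} \<Longrightarrow> uc g k = U k" "\<And>k. k \<in> {1..int L} \<Longrightarrow> yc g k = Y k"
      using trajectory_from_data[OF order pe[unfolded upy]] by blast
    have "(\<Sum>k=1..int L. supply_rate Q S R (uc g k) (yc g k)) \<ge> 0"
      using cond[OF p'(1), unfolded upy data_condition_iff[OF \<tau>(2) Q(1) S R(1)]] g s \<tau> by (auto simp: U_def Y_def)
    also have "(\<Sum>k=1..int L. supply_rate Q S R (uc g k) (yc g k)) = (\<Sum>k=1..int L. supply_rate Q S R (U k) (Y k))"
      using g by simp
    \<comment> \<open>The leading \<open>s\<close> terms are supplies of zero signals; the remaining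
      \<open>r\<close> terms are those of the given trajectory.\<close>
    also have "\<dots> = (\<Sum>k=1..int r. supply_rate Q S R (u' k) (y' k))"
      by (rule supply_sum_delay[OF s(2)])
        (use r \<tau> in \<open>auto simp: U_def Y_def s_def[symmetric] uy trunc_def prepend_def supply_rate_zero[OF Q(1) S R(1)]\<close>)
    finally show "(\<Sum>k=1..int r. supply_rate Q S R (u' k) (y' k)) \<ge> 0" .
  qed
  show ?thesis using i ii by (auto simp: adm_sched_trunc_def)
qed

end
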